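(* Let $F=\mathcal{F}_0+\sqrt{\mathcal{F}_0}f$. Then the relativistic BGK model of Marle $$\partial_tF+\frac{p}{p^0}\cdot\nabla_xF=\frac{1}{(1+\mathcal{I})p^0}(\mathcal{F}_E-F)$$ can be written as $$\partial_tf+\frac{p}{p^0}\cdot\nabla_xf=\frac{1}{(1+\mathcal{I})p^0}\{\mathcal{P}_0(f)-f\}+\Gamma(f).$$ Here $\mathcal{P}_0$ is the operator $$\begin{aligned}\mathcal{P}_0(f)&=\Big\{\int_0^\infty\!\!\int_{\mathbb{R}^3}f\sqrt{\mathcal{F}_0}\,\phi\,d\mathcal{I}\,dp\Big\}\sqrt{\mathcal{F}_0}+\gamma_0\Big\{\int_0^\infty\!\!\int_{\mathbb{R}^3}pf\sqrt{\mathcal{F}_0}\,\phi\,d\mathcal{I}\frac{dp}{p^0}\Big\}\cdot p(1+\mathcal{I})\sqrt{\mathcal{F}_0}\\&\quad+\frac{M^2(\gamma_0)}{M^2(\gamma_0)+M'(\gamma_0)\widetilde M(\gamma_0)}\Big\{\int_0^\infty\!\!\int_{\mathbb{R}^3}\Big(\frac{1}{(1+\mathcal{I})p^0}-\eta_0\Big)f\sqrt{\mathcal{F}_0}\,\phi\,d\mathcal{I}\,dp\Big\}\Big(\frac{M'(\gamma_0)}{M(\gamma_0)}+(1+\mathcal{I})p^0\Big)\sqrt{\mathcal{F}_0}\end{aligned}$$ and $\Gamma$ is the nonlinear operator $$\begin{aligned}\Gamma(f)&=\frac{N_n\sqrt{\mathcal{F}_0}}{(1+\mathcal{I})p^0}+\gamma_0N_u\cdot\frac{p}{p^0}\sqrt{\mathcal{F}_0}+\frac{M^2(\gamma_0)}{M^2(\gamma_0)+M'(\gamma_0)\widetilde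 M(\gamma_0)}\Big(\frac{1}{(1+\mathcal{I})p^0}\frac{M'(\gamma_0)}{M(\gamma_0)}+1\Big)N_\eta\sqrt{\mathcal{F}_0}\\&\quad+\frac{1}{(1+\mathcal{I})p^0\sqrt{\mathcal{F}_0}}\int_0^1(1-\theta)(n-1,u,\eta-\eta_0)\,\nabla^2_{(n_\theta,u_\theta,\eta_\theta)}\mathcal{F}_\theta\,(n-1,u,\eta-\eta_0)^T\,d\theta,\end{aligned}$$ where, writing $$A=\int_0^\infty\!\!\int_{\mathbb{R}^3}f\sqrt{\mathcal{F}_0}\,\phi\,d\mathcal{I}\,dp,\quad B=\int_0^\infty\!\!\int_{\mathbb{R}^3}pf\sqrt{\mathcal{F}_0}\,\phi\,d\mathcal{I}\frac{dp}{p^0}\in\mathbb{R}^3,\quad J=\int_0^\infty\!\!\int_{\mathbb{R}^3}f\sqrt{\mathcal{F}_0}(1+\mathcal{I})^{-1}\phi\,d\mathcal{I}\frac{dp}{p^0},$$ $$\Phi=2A+A^2-|B|^2,\qquad \Psi=A+N_n,$$ one has $$N_n=\tfrac12A^2-\tfrac12|B|^2-\frac{\Phi^2}{2(2+\Phi+2\sqrt{1+\Phi})},\qquad N_u=-\frac{A+N_n}{1+A+N_n}\,B,\qquad N_\eta=-\eta_0N_n+\eta_0\frac{\Psi^2}{1+\Psi}-\frac{\Psi}{1+\Psi}J.$$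
   Context: All physical constants are set to $1$. Here $t\ge0$, $x\in\mathbb{T}^3$, $p\in\mathbb{R}^3$, $\mathcal{I}\in[0,\infty)$, $p^0=\sqrt{1+|p|^2}$, and $\phi=\phi(\mathcal{I})=\mathcal{I}^{(D-2)/2}$ with a fixed $D>0$. For $\gamma>0$ set $$M(\gamma)=\int_0^\infty\int_{\mathbb{R}^3}e^{-(1+\mathcal{I})\gamma p^0}\phi\,d\mathcal{I}\,dp,\qquad \widetilde M(\gamma)=\int_0^\infty\int_{\mathbb{R}^3}e^{-(1+\mathcal{I})\gamma p^0}(1+\mathcal{I})^{-1}\phi\,d\mathcal{I}\,\frac{dp}{p^0}.$$ Given a distribution function $F$, define $n>0$, $u\in\mathbb{R}^3$ and $\eta$ by $$n^2=\Big(\int_0^\infty\!\!\int_{\mathbb{R}^3}F\phi\,d\mathcal{I}\,dp\Big)^2-\sum_{i=1}^3\Big(\int_0^\infty\!\!\int_{\mathbb{R}^3}p^iF\phi\,d\mathcal{I}\,\frac{dp}{p^0}\Big)^2,\quad u=\frac1n\int_0^\infty\!\!\int_{\mathbb{R}^3}pF\phi\,d\mathcal{I}\,\frac{dp}{p^0},\quad \eta=\frac1n\int_0^\infty\!\!\int_{\mathbb{R}^3}F(1+\mathcal{I})^{-1}\phi\,d\mathcal{I}\,\frac{dp}{p^0}.$$ Let $\mathcal{X}=(\widetilde M/M)^{-1}$ be the inverse function of $\gamma\mapsto\widetilde M(\gamma)/M(\gamma)$, so that the parameter $\gamma$ determined by $\widetilde M(\gamma)/M(\gamma)=\eta$ is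 $\gamma=\mathcal{X}(\eta)$. The generalized Jüttner distribution is $$\mathcal{F}_E=\frac{n}{M(\gamma)}e^{-(1+\mathcal{I})\gamma(u^0p^0-u\cdot p)},\qquad u^0=\sqrt{1+|u|^2}.$$ It is regarded as a function $\mathcal{F}(n,u,\eta;p,\mathcal{I})$ via $\gamma=\mathcal{X}(\eta)$. For a fixed $\gamma_0>0$, $\mathcal{F}_0=\frac{1}{M(\gamma_0)}e^{-\gamma_0(1+\mathcal{I})p^0}$ is the global equilibrium, and $\eta_0=\widetilde M(\gamma_0)/M(\gamma_0)$. The transitional distribution is $\mathcal{F}_\theta=\mathcal{F}(n_\theta,u_\theta,\eta_\theta;p,\mathcal{I})$ with $(n_\theta,u_\theta,\eta_\theta)=\theta(n,u,\eta)+(1-\theta)(1,0,\eta_0)$, $\theta\in[0,1]$, and $\nabla^2_{(n_\theta,u_\theta,\eta_\theta)}\mathcal{F}_\theta$ is the $5\times5$ Hessian of $\mathcal{F}$ with respect to $(n,u,\eta)$ evaluated at $(n_\theta,u_\theta,\eta_\theta)$. *)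

theory Defs
  imports "HOL-Analysis.Analysis"
begin

text \<open>
  Momenta are vectors in \<open>real ^ 3\<close>, internal energies are reals \<open>I \<ge> 0\<close>.  The position torus is
  \<open>\<real>\<^sup>3\<close> modulo the lattice of side \<open>L\<close>, i.e. functions on it are functions on \<open>real ^ 3\<close> that are
  \<open>L\<close>-periodic in each coordinate.
\<close>

definition p0 :: "real ^ 3 \<Rightarrow> real" where
  "p0 p = sqrt (1 + (norm p)\<^sup>2)"

text \<open>
  In Isabelle \<open>0 powr a = 0\<close> for every \<open>a\<close>; the value at \<open>I = 0\<close> is irrelevant, since \<open>phi\<close> only
  occurs as a weight under Lebesgue integrals in \<open>I\<close>.
\<close>
definition phi :: "real \<Rightarrow> real \<Rightarrow> real" where
  "phi D I = I powr ((D - 2) / 2)"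

text \<open>
  \<open>moment D h\<close> is the integral of \<open>h(p, I) \<phi>(I)\<close> over \<open>p \<in> \<real>\<^sup>3\<close> and \<open>I \<in> [0, \<infinity>)\<close> for real- or
  vector-valued \<open>h\<close>, taken with respect to Lebesgue measure on the product.
\<close>
definition moment :: "real \<Rightarrow> (real ^ 3 \<Rightarrow> real \<Rightarrow> 'b) \<Rightarrow> 'b::{banach, second_countable_topology}" where
  "moment D h = (LINT z : UNIV \<times> {0..} | lborel. phi D (snd z) *\<^sub>R h (fst z) (snd z))"

definition moment_exists :: "real \<Rightarrow> (real ^ 3 \<Rightarrow> real \<Rightarrow> 'b::{banach, second_countable_topology}) \<Rightarrow> bool" where
  "moment_exists D h \<longleftrightarrow>
     set_integrable lborel (UNIV \<times> {0..}) (\<lambda>z. phi D (snd z) *\<^sub>R h (fst z) (snd z))"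

definition M_fun :: "real \<Rightarrow> real \<Rightarrow> real" where
  "M_fun D \<gamma> = moment D (\<lambda>p I. exp (- (1 + I) * \<gamma> * p0 p))"

definition Mt_fun :: "real \<Rightarrow> real \<Rightarrow> real" where
  "Mt_fun D \<gamma> = moment D (\<lambda>p I. exp (- (1 + I) * \<gamma> * p0 p) / ((1 + I) * p0 p))"

definition M_ratio :: "real \<Rightarrow> real \<Rightarrow> real" where
  "M_ratio D \<gamma> = Mt_fun D \<gamma> / M_fun D \<gamma>"

definition chi_inv :: "real \<Rightarrow> real \<Rightarrow> real" where
  "chi_inv D = the_inv_into {0<..} (M_ratio D)"


subsection \<open>Macroscopic fields of a distribution in \<open>(p, I)\<close>\<close>

definition flux :: "real \<Rightarrow> (real ^ 3 \<Rightarrow> real \<Rightarrow> real) \<Rightarrow> real ^ 3" where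
  "flux D g = moment D (\<lambda>p I. (g p I / p0 p) *\<^sub>R p)"

definition number_sq :: "real \<Rightarrow> (real ^ 3 \<Rightarrow> real \<Rightarrow> real) \<Rightarrow> real" where
  "number_sq D g = (moment D g)\<^sup>2 - (\<Sum>i\<in>UNIV. (flux D g $ i)\<^sup>2)"

definition n_of :: "real \<Rightarrow> (real ^ 3 \<Rightarrow> real \<Rightarrow> real) \<Rightarrow> real" where
  "n_of D g = sqrt (number_sq D g)"

definition u_of :: "real \<Rightarrow> (real ^ 3 \<Rightarrow> real \<Rightarrow> real) \<Rightarrow> real ^ 3" where
  "u_of D g = (1 / n_of D g) *\<^sub>R flux D g"

definition eta_of :: "real \<Rightarrow> (real ^ 3 \<Rightarrow> real \<Rightarrow> real) \<Rightarrow> real" where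
  "eta_of D g = (1 / n_of D g) * moment D (\<lambda>p I. g p I / ((1 + I) * p0 p))"

text \<open>
  The distributions for which the macroscopic fields and the temperature parameter are defined: the
  moments converge (the weights \<open>p / p0\<close> and \<open>1 / ((1 + I) p0)\<close> are bounded by 1, so the zeroth
  moment suffices), \<open>n\<^sup>2\<close> is positive so that there is an \<open>n > 0\<close>, and \<open>\<eta>\<close> lies in the domain of the
  inverse function \<open>chi_inv D\<close>, that is, some \<open>\<gamma> > 0\<close> satisfies \<open>M_ratio D \<gamma> = \<eta>\<close>.
\<close>
definition has_juettner_parameters :: "real \<Rightarrow> (real ^ 3 \<Rightarrow> real \<Rightarrow> real) \<Rightarrow> bool" where
  "has_juettner_parameters D g \<longleftrightarrow>
     moment_exists D g \<and> number_sq D g > 0 \<and> eta_of D g \<in> M_ratio D ` {0<..}"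


subsection \<open>Generalized Juettner distribution\<close>

definition juettner :: "real \<Rightarrow> real \<Rightarrow> real ^ 3 \<Rightarrow> real \<Rightarrow> real ^ 3 \<Rightarrow> real \<Rightarrow> real" where
  "juettner D n u \<eta> p I =
     (let \<gamma> = chi_inv D \<eta>; u0 = sqrt (1 + (norm u)\<^sup>2)
      in n / M_fun D \<gamma> * exp (- (1 + I) * \<gamma> * (u0 * p0 p - u \<bullet> p)))"

definition F_E :: "real \<Rightarrow> (real ^ 3 \<Rightarrow> real \<Rightarrow> real) \<Rightarrow> real ^ 3 \<Rightarrow> real \<Rightarrow> real" where
  "F_E D g = juettner D (n_of D g) (u_of D g) (eta_of D g)"

definition F0 :: "real \<Rightarrow> real \<Rightarrow> real ^ 3 \<Rightarrow> real \<Rightarrow> real" where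
  "F0 D \<gamma>0 p I = 1 / M_fun D \<gamma>0 * exp (- \<gamma>0 * (1 + I) * p0 p)"

definition eta0 :: "real \<Rightarrow> real \<Rightarrow> real" where
  "eta0 D \<gamma>0 = M_ratio D \<gamma>0"

definition perturbed :: "real \<Rightarrow> real \<Rightarrow> (real ^ 3 \<Rightarrow> real \<Rightarrow> real) \<Rightarrow> real ^ 3 \<Rightarrow> real \<Rightarrow> real" where
  "perturbed D \<gamma>0 g p I = F0 D \<gamma>0 p I + sqrt (F0 D \<gamma>0 p I) * g p I"


subsection \<open>Hessian with respect to the five macroscopic parameters\<close>

definition params :: "real \<Rightarrow> real ^ 3 \<Rightarrow> real \<Rightarrow> real ^ 5" where
  "params n u \<eta> = vector [n, u $ 1, u $ 2, u $ 3, \<eta>]"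

definition juettner_params :: "real \<Rightarrow> real ^ 3 \<Rightarrow> real \<Rightarrow> real ^ 5 \<Rightarrow> real" where
  "juettner_params D p I y = juettner D (y $ 1) (vector [y $ 2, y $ 3, y $ 4]) (y $ 5) p I"

lemma juettner_params_params: "juettner_params D p I (params n u \<eta>) = juettner D n u \<eta> p I"
proof -
  have e: "params n u \<eta> $ 1 = n" "params n u \<eta> $ 2 = u$1" "params n u \<eta> $ 3 = u$2"
     "params n u \<eta> $ 4 = u$3" "params n u \<eta> $ 5 = \<eta>"
    by (simp_all add: params_def vector_def)
  have "(vector [u$1,u$2,u$3] :: real^3) = u" by (simp add: vec_eq_iff forall_3)
  then show ?thesis by (simp add: juettner_params_def e)
qed

definition partial_deriv :: "'n \<Rightarrow> (real ^ 'n \<Rightarrow> real) \<Rightarrow> real ^ 'n \<Rightarrow> real" where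
  "partial_deriv i g y = deriv (\<lambda>s. g (y + s *\<^sub>R axis i 1)) 0"

definition hessian :: "(real ^ 'n \<Rightarrow> real) \<Rightarrow> real ^ 'n \<Rightarrow> real ^ 'n ^ 'n" where
  "hessian g y = (\<chi> i j. partial_deriv i (partial_deriv j g) y)"


subsection \<open>The operators of the perturbation equation\<close>

definition eta_coeff :: "real \<Rightarrow> real \<Rightarrow> real" where
  "eta_coeff D \<gamma>0 =
     (M_fun D \<gamma>0)\<^sup>2 / ((M_fun D \<gamma>0)\<^sup>2 + deriv (M_fun D) \<gamma>0 * Mt_fun D \<gamma>0)"

definition P0_op ::
    "real \<Rightarrow> real \<Rightarrow> (real ^ 3 \<Rightarrow> real \<Rightarrow> real) \<Rightarrow> real ^ 3 \<Rightarrow> real \<Rightarrow> real" where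
  "P0_op D \<gamma>0 g p I =
     (let w = (\<lambda>q J. sqrt (F0 D \<gamma>0 q J)) in
      moment D (\<lambda>q J. g q J * w q J) * w p I
      + \<gamma>0 * (moment D (\<lambda>q J. (g q J * w q J / p0 q) *\<^sub>R q) \<bullet> p) * (1 + I) * w p I
      + eta_coeff D \<gamma>0
        * moment D (\<lambda>q J. (1 / ((1 + J) * p0 q) - eta0 D \<gamma>0) * g q J * w q J)
        * (deriv (M_fun D) \<gamma>0 / M_fun D \<gamma>0 + (1 + I) * p0 p) * w p I)"

definition A_of :: "real \<Rightarrow> real \<Rightarrow> (real ^ 3 \<Rightarrow> real \<Rightarrow> real) \<Rightarrow> real" where
  "A_of D \<gamma>0 g = moment D (\<lambda>p I. g p I * sqrt (F0 D \<gamma>0 p I))"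

definition B_of :: "real \<Rightarrow> real \<Rightarrow> (real ^ 3 \<Rightarrow> real \<Rightarrow> real) \<Rightarrow> real ^ 3" where
  "B_of D \<gamma>0 g = moment D (\<lambda>p I. (g p I * sqrt (F0 D \<gamma>0 p I) / p0 p) *\<^sub>R p)"

definition J_of :: "real \<Rightarrow> real \<Rightarrow> (real ^ 3 \<Rightarrow> real \<Rightarrow> real) \<Rightarrow> real" where
  "J_of D \<gamma>0 g = moment D (\<lambda>p I. g p I * sqrt (F0 D \<gamma>0 p I) / ((1 + I) * p0 p))"

definition Phi_of :: "real \<Rightarrow> real \<Rightarrow> (real ^ 3 \<Rightarrow> real \<Rightarrow> real) \<Rightarrow> real" where
  "Phi_of D \<gamma>0 g = 2 * A_of D \<gamma>0 g + (A_of D \<gamma>0 g)\<^sup>2 - (norm (B_of D \<gamma>0 g))\<^sup>2"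

definition N_n :: "real \<Rightarrow> real \<Rightarrow> (real ^ 3 \<Rightarrow> real \<Rightarrow> real) \<Rightarrow> real" where
  "N_n D \<gamma>0 g =
     (let \<Phi> = Phi_of D \<gamma>0 g in
      (A_of D \<gamma>0 g)\<^sup>2 / 2 - (norm (B_of D \<gamma>0 g))\<^sup>2 / 2
      - \<Phi>\<^sup>2 / (2 * (2 + \<Phi> + 2 * sqrt (1 + \<Phi>))))"

definition Psi_of :: "real \<Rightarrow> real \<Rightarrow> (real ^ 3 \<Rightarrow> real \<Rightarrow> real) \<Rightarrow> real" where
  "Psi_of D \<gamma>0 g = A_of D \<gamma>0 g + N_n D \<gamma>0 g"

definition N_u :: "real \<Rightarrow> real \<Rightarrow> (real ^ 3 \<Rightarrow> real \<Rightarrow> real) \<Rightarrow> real ^ 3" where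
  "N_u D \<gamma>0 g =
     - ((A_of D \<gamma>0 g + N_n D \<gamma>0 g) / (1 + A_of D \<gamma>0 g + N_n D \<gamma>0 g)) *\<^sub>R B_of D \<gamma>0 g"

definition N_eta :: "real \<Rightarrow> real \<Rightarrow> (real ^ 3 \<Rightarrow> real \<Rightarrow> real) \<Rightarrow> real" where
  "N_eta D \<gamma>0 g =
     (let \<Psi> = Psi_of D \<gamma>0 g in
      - eta0 D \<gamma>0 * N_n D \<gamma>0 g + eta0 D \<gamma>0 * (\<Psi>\<^sup>2 / (1 + \<Psi>)) - \<Psi> / (1 + \<Psi>) * J_of D \<gamma>0 g)"

text \<open>
  \<open>d\<close> is the increment \<open>(n - 1, u, \<eta> - \<eta>\<^sub>0)\<close>, where \<open>(n, u, \<eta>)\<close> are the fields of the perturbed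
  distribution.
\<close>
definition Gamma_op ::
    "real \<Rightarrow> real \<Rightarrow> (real ^ 3 \<Rightarrow> real \<Rightarrow> real) \<Rightarrow> real ^ 3 \<Rightarrow> real \<Rightarrow> real" where
  "Gamma_op D \<gamma>0 g p I =
     (let w = sqrt (F0 D \<gamma>0 p I);
          G = perturbed D \<gamma>0 g;
          n = n_of D G; u = u_of D G; \<eta> = eta_of D G;
          d = params (n - 1) u (\<eta> - eta0 D \<gamma>0);
          y = (\<lambda>\<theta>. \<theta> *\<^sub>R params n u \<eta> + (1 - \<theta>) *\<^sub>R params 1 0 (eta0 D \<gamma>0))
      in N_n D \<gamma>0 g * w / ((1 + I) * p0 p)
         + \<gamma>0 * (N_u D \<gamma>0 g \<bullet> ((1 / p0 p) *\<^sub>R p)) * w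
         + eta_coeff D \<gamma>0
           * (1 / ((1 + I) * p0 p) * (deriv (M_fun D) \<gamma>0 / M_fun D \<gamma>0) + 1) * N_eta D \<gamma>0 g * w
         + 1 / ((1 + I) * p0 p * w)
           * integral {0..1}
               (\<lambda>\<theta>. (1 - \<theta>) * (d \<bullet> (hessian (juettner_params D p I) (y \<theta>) *v d))))"


subsection \<open>The transport equations\<close>

text \<open>
  \<open>transport_eq h t x p I S\<close>: at \<open>(t, x, p, I)\<close> the function \<open>h\<close> is differentiable in time
  (one-sided at \<open>t = 0\<close>) and in space, and
  \<open>\<partial>\<^sub>t h + (p / p0) \<bullet> \<nabla>\<^sub>x h = S\<close> holds there.
\<close>
definition transport_eq ::
    "(real \<Rightarrow> real ^ 3 \<Rightarrow> real ^ 3 \<Rightarrow> real \<Rightarrow> real) \<Rightarrow> real \<Rightarrow> real ^ 3 \<Rightarrow> real ^ 3 \<Rightarrow> real \<Rightarrow> real \<Rightarrow> bool" where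
  "transport_eq h t x p I S \<longleftrightarrow>
     (\<exists>ht hx. ((\<lambda>s. h s x p I) has_real_derivative ht) (at t within {0..}) \<and>
              (GDERIV (\<lambda>y. h t y p I) x :> hx) \<and>
              ht + ((1 / p0 p) *\<^sub>R p) \<bullet> hx = S)"

definition marle_eq ::
    "real \<Rightarrow> (real \<Rightarrow> real ^ 3 \<Rightarrow> real ^ 3 \<Rightarrow> real \<Rightarrow> real) \<Rightarrow> real \<Rightarrow> real ^ 3 \<Rightarrow> real ^ 3 \<Rightarrow> real \<Rightarrow> bool" where
  "marle_eq D F t x p I \<longleftrightarrow>
     transport_eq F t x p I (1 / ((1 + I) * p0 p) * (F_E D (F t x) p I - F t x p I))"

definition perturbation_eq ::
    "real \<Rightarrow> real \<Rightarrow> (real \<Rightarrow> real ^ 3 \<Rightarrow> real ^ 3 \<Rightarrow> real \<Rightarrow> real) \<Rightarrow> real \<Rightarrow> real ^ 3 \<Rightarrow> real ^ 3 \<Rightarrow> real \<Rightarrow> bool" where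
  "perturbation_eq D \<gamma>0 f t x p I \<longleftrightarrow>
     transport_eq f t x p I
       (1 / ((1 + I) * p0 p) * (P0_op D \<gamma>0 (f t x) p I - f t x p I) + Gamma_op D \<gamma>0 (f t x) p I)"

definition torus_periodic ::
    "real \<Rightarrow> (real \<Rightarrow> real ^ 3 \<Rightarrow> real ^ 3 \<Rightarrow> real \<Rightarrow> real) \<Rightarrow> bool" where
  "torus_periodic L h \<longleftrightarrow>
     (\<forall>t\<ge>0. \<forall>x p. \<forall>I\<ge>0. \<forall>i. h t (x + L *\<^sub>R axis i 1) p I = h t x p I)"

end

theory Submission
  imports Defs
begin

text \<open>
  With \<open>X = (1 + I) p\<^sup>0\<close> and \<open>W j \<gamma> = \<integral> X\<^sup>j\<^sup>-\<^sup>1 exp (- \<gamma> X) \<phi>\<close> one has \<open>M = W 1\<close>, \<open>Mt = W 0\<close> and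
  \<open>W j' = - W (j + 1)\<close>.  Hence \<open>(Mt / M)' = W 0 W 2 / (W 1)\<^sup>2 - 1\<close>, which is positive by the strict
  Cauchy--Schwarz inequality because \<open>X\<close> is not constant: \<open>Mt / M\<close> is strictly increasing onto an
  open interval and its inverse is twice differentiable.  So the Juettner distribution is twice
  differentiable in \<open>(n, u, \<eta>)\<close> near the segment from \<open>(1, 0, \<eta>\<^sub>0)\<close>, and Taylor's formula along this
  segment, combined with the exact identities \<open>n - 1 = A + N_n\<close>, \<open>u = B + N_u\<close> and
  \<open>\<eta> - \<eta>\<^sub>0 = J - \<eta>\<^sub>0 A + N_eta\<close>, yields the linear part \<open>P\<^sub>0 f\<close> and the remainder \<open>\<Gamma>(f)\<close>.
\<close>

subsection \<open>Laplace moments\<close>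

lemma abs_exp_minus_one_minus_le:
  fixes y :: real
  shows "\<bar>exp y - 1 - y\<bar> \<le> y\<^sup>2 * exp \<bar>y\<bar>"
proof -
  have lo: "0 \<le> exp y - 1 - y"
    using exp_ge_add_one_self[of y] by linarith
  \<comment> \<open>The inequality \<open>exp z >= 1 + z\<close> is now used at
    \<open>z = - y\<close>. Together with \<open>lo\<close> it encloses the remainder between
    \<open>0\<close> and \<open>y * (exp y - 1)\<close>, and each sign of \<open>y\<close> then
    needs only one more elementary bound.\<close>
  have "exp y * (1 - y) \<le> exp y * exp (- y)"
    using exp_ge_add_one_self[of "- y"] by (intro mult_left_mono) auto
  then have up: "exp y - 1 - y \<le> y * (exp y - 1)"
    by (simp add: exp_minus algebra_simps)
  show ?thesis
  proof (cases "y \<ge> 0")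
    case True
    have "exp y - 1 \<le> y * exp y"
      using up lo by (simp add: algebra_simps)
    then have "y * (exp y - 1) \<le> y * (y * exp y)"
      using True by (intro mult_left_mono)
    then show ?thesis using lo up True by (simp add: power2_eq_square)
  next
    case False
    have "(- y) * (1 - exp y) \<le> (- y) * (- y)"
      using False exp_ge_add_one_self[of y] by (intro mult_left_mono; linarith)
    then have "exp y - 1 - y \<le> y\<^sup>2 * 1"
      using up by (simp add: power2_eq_square algebra_simps)
    also have "\<dots> \<le> y\<^sup>2 * exp \<bar>y\<bar>"
      by (intro mult_left_mono) auto
    finally show ?thesis using lo by simp
  qed
qed

text \<open>A single term of the exponential series is at most the whole sum, since all terms are
  nonnegative.\<close>

lemma power_le_fact_mult_exp:
  fixes x :: real
  assumes "x \<ge> 0"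
  shows "x ^ n \<le> fact n * exp x"
proof -
  have "(\<Sum>k\<in>{n}. x ^ k /\<^sub>R fact k) \<le> (\<Sum>k. x ^ k /\<^sub>R fact k)"
    using assms by (intro sum_le_suminf summable_exp_generic) auto
  then show ?thesis
    by (simp add: exp_def field_simps)
qed

text \<open>The difference quotient misses \<open>d\<close> by at most
  \<open>K * \<bar>h\<bar>\<close>. This form suits parameter integrals, where a second-order
  remainder can be bounded directly under the integral sign.\<close>

lemma has_real_derivative_quadratic_bound:
  fixes f :: "real \<Rightarrow> real"
  assumes "\<delta> > 0"
    and "\<And>h. \<bar>h\<bar> < \<delta> \<Longrightarrow> \<bar>f (x + h) - f x - h * d\<bar> \<le> K * h\<^sup>2"
  shows "(f has_real_derivative d) (at x)"
proof -
  have "((\<lambda>h. (f (x + h) - f x) / h - d) \<longlongrightarrow> 0) (at 0)"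
  proof (rule Lim_null_comparison)
    show "\<forall>\<^sub>F h in at 0. norm ((f (x + h) - f x) / h - d) \<le> K * \<bar>h\<bar>"
      unfolding eventually_at
    proof (intro exI[of _ \<delta>] conjI ballI impI)
      fix h :: real assume h: "h \<noteq> 0 \<and> dist h 0 < \<delta>"
      have "norm ((f (x + h) - f x) / h - d) = \<bar>f (x + h) - f x - h * d\<bar> / \<bar>h\<bar>"
        using h by (simp add: field_simps flip: abs_divide)
      also have "\<dots> \<le> K * h\<^sup>2 / \<bar>h\<bar>"
        using assms(2)[of h] h by (intro divide_right_mono) auto
      also have "\<dots> = K * \<bar>h\<bar>"
        using h by (simp add: power2_eq_square field_simps)
      finally show "norm ((f (x + h) - f x) / h - d) \<le> K * \<bar>h\<bar>" .
    qed (fact assms(1))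
    show "((\<lambda>h. K * \<bar>h\<bar>) \<longlongrightarrow> 0) (at 0)"
      by (rule tendsto_eq_intros refl | simp)+
  qed
  then show ?thesis
    unfolding DERIV_def by (simp add: LIM_zero_iff)
qed

text \<open>The abstract setting for \<open>M\<close> and \<open>Mt\<close>: \<open>N\<close> will
  be Lebesgue measure weighted by \<open>phi\<close>, and \<open>X\<close> the particle energy.
  Besides making Cauchy-Schwarz strict, \<open>X_not_const\<close> excludes the null measure, under
  which every statement holds almost everywhere.\<close>

locale exp_moments =
  fixes N :: "'a measure" and X :: "'a \<Rightarrow> real"
  assumes X_measurable [measurable]: "X \<in> borel_measurable N"
    and X_ge_1: "X z \<ge> 1"
    and integrable_exp: "\<gamma> > 0 \<Longrightarrow> integrable N (\<lambda>z. exp (- \<gamma> * X z))"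
    and X_not_const: "\<not> (AE z in N. X z = c)"
begin

text \<open>The effective power is \<open>j - 1\<close>; dividing by \<open>X\<close> keeps the
  index a natural number although the family starts with the reciprocal weight of
  \<open>Mt\<close>.\<close>

definition E :: "nat \<Rightarrow> real \<Rightarrow> 'a \<Rightarrow> real" where
  "E j \<gamma> z = X z ^ j * exp (- \<gamma> * X z) / X z"

definition W :: "nat \<Rightarrow> real \<Rightarrow> real" where
  "W j \<gamma> = integral\<^sup>L N (E j \<gamma>)"

lemma E_measurable [measurable]: "E j \<gamma> \<in> borel_measurable N"
  unfolding E_def by measurable

lemma X_pos: "X z > 0"
  using X_ge_1[of z] by linarith

lemma E_pos: "E j \<gamma> z > 0"
  using X_pos by (simp add: E_def)

text \<open>Half of the exponential decay absorbs the power: \<open>X ^ j\<close> is at most a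
  constant times \<open>exp (\<gamma> / 2 * X)\<close>, and the remaining factor
  \<open>exp (- (\<gamma> / 2) * X)\<close> is integrable.\<close>

lemma integrable_E:
  assumes "\<gamma> > 0"
  shows "integrable N (E j \<gamma>)"
proof (rule Bochner_Integration.integrable_bound)
  show "integrable N (\<lambda>z. (fact j * (2 / \<gamma>) ^ j) * exp (- (\<gamma> / 2) * X z))"
    using assms by (intro integrable_mult_right integrable_exp) auto
  show "AE z in N. norm (E j \<gamma> z) \<le> norm ((fact j * (2 / \<gamma>) ^ j) * exp (- (\<gamma> / 2) * X z))"
  proof (rule AE_I2)
    fix z
    have "(\<gamma> / 2 * X z) ^ j \<le> fact j * exp (\<gamma> / 2 * X z)"
      using assms X_pos[of z] by (intro power_le_fact_mult_exp) auto
    then have "(2 / \<gamma>) ^ j * (\<gamma> / 2 * X z) ^ j \<le> (2 / \<gamma>) ^ j * (fact j * exp (\<gamma> / 2 * X z))"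
      using assms by (intro mult_left_mono) auto
    then have "X z ^ j \<le> fact j * (2 / \<gamma>) ^ j * exp (\<gamma> / 2 * X z)"
      using assms by (simp add: mult_ac flip: power_mult_distrib)
    then have "X z ^ j * exp (- \<gamma> * X z)
        \<le> fact j * (2 / \<gamma>) ^ j * exp (\<gamma> / 2 * X z) * exp (- \<gamma> * X z)"
      by (intro mult_right_mono) auto
    also have "\<dots> = fact j * (2 / \<gamma>) ^ j * exp (- (\<gamma> / 2) * X z)"
      by (simp add: mult.assoc flip: exp_add)
    finally have le: "X z ^ j * exp (- \<gamma> * X z) \<le> fact j * (2 / \<gamma>) ^ j * exp (- (\<gamma> / 2) * X z)" .
    have "E j \<gamma> z \<le> X z ^ j * exp (- \<gamma> * X z) / 1"
      unfolding E_def using X_ge_1[of z] by (intro divide_left_mono) auto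
    with le show "norm (E j \<gamma> z) \<le> norm ((fact j * (2 / \<gamma>) ^ j) * exp (- (\<gamma> / 2) * X z))"
      using assms E_pos[of j \<gamma> z] by (simp add: abs_mult)
  qed
qed measurable

text \<open>A strictly positive integrand has zero integral only over a null measure, and that would
  make \<open>X\<close> almost everywhere equal to any constant.\<close>

lemma W_pos:
  assumes "\<gamma> > 0"
  shows "W j \<gamma> > 0"
proof -
  have nn: "AE z in N. 0 \<le> E j \<gamma> z"
    using E_pos by (intro AE_I2) (simp add: less_imp_le)
  have "W j \<gamma> \<noteq> 0"
  proof
    assume "W j \<gamma> = 0"
    then have "AE z in N. E j \<gamma> z = 0"
      using integral_nonneg_eq_0_iff_AE[OF integrable_E[OF assms] nn] by (simp add: W_def)
    then have "AE z in N. X z = 0"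
      by eventually_elim (use E_pos in \<open>auto simp: less_le\<close>)
    then show False using X_not_const by blast
  qed
  moreover have "W j \<gamma> \<ge> 0"
    unfolding W_def by (rule integral_nonneg_AE[OF nn])
  ultimately show ?thesis by simp
qed

text \<open>Expanding \<open>exp (- h * X)\<close> to first order leaves an error dominated by
  \<open>h\<^sup>2 * E (j + 2) (\<gamma> / 2)\<close>, whose integral is finite and does not depend
  on the shift otherwise.\<close>

lemma W_has_derivative:
  assumes "\<gamma> > 0"
  shows "(W j has_real_derivative - W (Suc j) \<gamma>) (at \<gamma>)"
proof (rule has_real_derivative_quadratic_bound)
  show "\<gamma> / 2 > 0" using assms by simp
  fix h :: real assume h: "\<bar>h\<bar> < \<gamma> / 2"
  have int: "integrable N (E j (\<gamma> + h))" "integrable N (E j \<gamma>)" "integrable N (E (Suc j) \<gamma>)"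
    "integrable N (E (j + 2) (\<gamma> / 2))"
    using h assms by (auto intro!: integrable_E)
  have "W j (\<gamma> + h) - W j \<gamma> - h * - W (Suc j) \<gamma>
      = (\<integral>z. E j (\<gamma> + h) z - E j \<gamma> z + h * E (Suc j) \<gamma> z \<partial>N)"
    using int by (simp add: W_def)
  also have "\<bar>\<dots>\<bar> \<le> (\<integral>z. \<bar>E j (\<gamma> + h) z - E j \<gamma> z + h * E (Suc j) \<gamma> z\<bar> \<partial>N)"
    by (rule integral_abs_bound)
  also have "\<dots> \<le> (\<integral>z. h\<^sup>2 * E (j + 2) (\<gamma> / 2) z \<partial>N)"
  proof (rule integral_mono)
    fix z
    have X: "X z > 0" by (rule X_pos)
    have "exp (- (\<gamma> + h) * X z) = exp (- \<gamma> * X z) * exp (- h * X z)"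
      by (simp add: algebra_simps flip: exp_add)
    then have "E j (\<gamma> + h) z - E j \<gamma> z + h * E (Suc j) \<gamma> z
        = E j \<gamma> z * (exp (- h * X z) - 1 - (- h * X z))"
      unfolding E_def using X by (simp add: field_simps)
    also have "\<bar>\<dots>\<bar> = E j \<gamma> z * \<bar>exp (- h * X z) - 1 - (- h * X z)\<bar>"
      using E_pos[of j \<gamma> z] by (simp add: abs_mult)
    also have "\<dots> \<le> E j \<gamma> z * ((- h * X z)\<^sup>2 * exp \<bar>- h * X z\<bar>)"
      using E_pos[of j \<gamma> z] by (intro mult_left_mono abs_exp_minus_one_minus_le) auto
    \<comment> \<open>Restricting to \<open>\<bar>h\<bar> < \<gamma> / 2\<close> makes the
      dominating function independent of \<open>h\<close> apart from the square, at the price of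
      half of the decay.\<close>
    also have "\<dots> \<le> E j \<gamma> z * ((- h * X z)\<^sup>2 * exp (\<gamma> / 2 * X z))"
      using E_pos[of j \<gamma> z] X h by (intro mult_left_mono) (auto simp: abs_mult)
    also have "\<dots> = h\<^sup>2 * E (j + 2) (\<gamma> / 2) z"
    proof -
      have "exp (- (\<gamma> / 2) * X z) = exp (- \<gamma> * X z) * exp (\<gamma> / 2 * X z)"
        by (simp flip: exp_add)
      then show ?thesis
        unfolding E_def by (simp add: power2_eq_square power_add)
    qed
    finally show "\<bar>E j (\<gamma> + h) z - E j \<gamma> z + h * E (Suc j) \<gamma> z\<bar> \<le> h\<^sup>2 * E (j + 2) (\<gamma> / 2) z" .
  qed (use int in auto)
  also have "\<dots> = W (j + 2) (\<gamma> / 2) * h\<^sup>2"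
    by (simp add: W_def)
  finally show "\<bar>W j (\<gamma> + h) - W j \<gamma> - h * - W (Suc j) \<gamma>\<bar> \<le> W (j + 2) (\<gamma> / 2) * h\<^sup>2" .
qed

lemma W_Cauchy_Schwarz_strict:
  assumes "\<gamma> > 0"
  shows "(W 1 \<gamma>)\<^sup>2 < W 0 \<gamma> * W 2 \<gamma>"
proof -
  \<comment> \<open>The quotient \<open>b / a\<close> is the mean of \<open>X\<close> under the
    weight \<open>E 0\<close>, so \<open>Q\<close> is \<open>a\<^sup>2\<close> times the density of
    the variance; its integral vanishes only if \<open>X\<close> is almost everywhere
    constant.\<close>
  define a b where "a = W 0 \<gamma>" and "b = W 1 \<gamma>"
  define Q where "Q z = a\<^sup>2 * E 2 \<gamma> z - 2 * a * b * E 1 \<gamma> z + b\<^sup>2 * E 0 \<gamma> z" for z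
  have a: "a > 0" unfolding a_def by (rule W_pos[OF assms])
  have Q: "Q z = (a * X z - b)\<^sup>2 * E 0 \<gamma> z" for z
    unfolding Q_def E_def using X_pos[of z] by (simp add: field_simps power2_eq_square)
  have int: "integrable N (E j \<gamma>)" for j
    by (rule integrable_E[OF assms])
  have intQ: "integrable N Q"
    unfolding Q_def using int by simp
  have nn: "AE z in N. 0 \<le> Q z"
    unfolding Q using E_pos by (intro AE_I2) (simp add: less_imp_le)
  have "integral\<^sup>L N Q = a\<^sup>2 * W 2 \<gamma> - 2 * a * b * W 1 \<gamma> + b\<^sup>2 * W 0 \<gamma>"
    unfolding Q_def W_def using int by simp
  also have "\<dots> = a * (W 0 \<gamma> * W 2 \<gamma> - (W 1 \<gamma>)\<^sup>2)"
    by (simp add: a_def b_def power2_eq_square algebra_simps)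
  finally have eq: "integral\<^sup>L N Q = a * (W 0 \<gamma> * W 2 \<gamma> - (W 1 \<gamma>)\<^sup>2)" .
  have "integral\<^sup>L N Q \<noteq> 0"
  proof
    assume "integral\<^sup>L N Q = 0"
    then have "AE z in N. Q z = 0"
      using integral_nonneg_eq_0_iff_AE[OF intQ nn] by simp
    then have "AE z in N. X z = b / a"
    proof eventually_elim
      case (elim z)
      then show ?case using E_pos[of 0 \<gamma> z] a by (simp add: Q field_simps)
    qed
    then show False using X_not_const by blast
  qed
  moreover have "integral\<^sup>L N Q \<ge> 0"
    by (rule integral_nonneg_AE[OF nn])
  ultimately have "0 < integral\<^sup>L N Q"
    by (simp add: less_le)
  then have "0 < a * (W 0 \<gamma> * W 2 \<gamma> - (W 1 \<gamma>)\<^sup>2)"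
    unfolding eq .
  then show ?thesis
    using a by (simp add: zero_less_mult_iff)
qed

end

subsection \<open>Taylor expansion with integral remainder\<close>

text \<open>Here \<open>G\<close> is the gradient. For open \<open>S\<close> it is determined near
  every point of \<open>S\<close>, so its differentiability is second-order differentiability of
  \<open>g\<close>; the second derivative may be discontinuous.\<close>

definition twice_differentiable_on :: "('a::euclidean_space \<Rightarrow> real) \<Rightarrow> 'a set \<Rightarrow> bool" where
  "twice_differentiable_on g S \<longleftrightarrow>
     (\<exists>G. \<forall>y\<in>S. (g has_derivative (\<lambda>d. d \<bullet> G y)) (at y) \<and> G differentiable (at y))"

lemma twice_differentiable_on_const: "twice_differentiable_on (\<lambda>_. c) S"
  unfolding twice_differentiable_on_def by (rule exI[of _ "\<lambda>_. 0"]) simp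

lemma twice_differentiable_on_inner: "twice_differentiable_on (\<lambda>y. y \<bullet> c) S"
  unfolding twice_differentiable_on_def
  by (rule exI[of _ "\<lambda>_. c"])
    (auto intro!: bounded_linear_imp_has_derivative bounded_linear_inner_left)

lemma twice_differentiable_on_nth:
  fixes S :: "(real ^ 'n) set"
  shows "twice_differentiable_on (\<lambda>y. y $ i) S"
  using twice_differentiable_on_inner[of "axis i 1" S] by (simp add: inner_axis)

lemma twice_differentiable_on_add:
  assumes "twice_differentiable_on f S" "twice_differentiable_on g S"
  shows "twice_differentiable_on (\<lambda>y. f y + g y) S"
proof -
  obtain F G where
    "\<forall>y\<in>S. (f has_derivative (\<lambda>d. d \<bullet> F y)) (at y) \<and> F differentiable (at y)"
    "\<forall>y\<in>S. (g has_derivative (\<lambda>d. d \<bullet> G y)) (at y) \<and> G differentiable (at y)"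
    using assms unfolding twice_differentiable_on_def by blast
  then show ?thesis
    unfolding twice_differentiable_on_def
    by (intro exI[of _ "\<lambda>y. F y + G y"] ballI conjI)
      (simp_all add: inner_add_right has_derivative_add)
qed

lemma twice_differentiable_on_mult:
  assumes "twice_differentiable_on f S" "twice_differentiable_on g S"
  shows "twice_differentiable_on (\<lambda>y. f y * g y) S"
proof -
  obtain F G where
    F: "\<forall>y\<in>S. (f has_derivative (\<lambda>d. d \<bullet> F y)) (at y) \<and> F differentiable (at y)" and
    G: "\<forall>y\<in>S. (g has_derivative (\<lambda>d. d \<bullet> G y)) (at y) \<and> G differentiable (at y)"
    using assms unfolding twice_differentiable_on_def by blast
  have "((\<lambda>y. f y * g y) has_derivative (\<lambda>d. d \<bullet> (f y *\<^sub>R G y + g y *\<^sub>R F y))) (at y)"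
    if "y \<in> S" for y
    by (rule has_derivative_eq_rhs[OF has_derivative_mult])
      (use F G that in \<open>auto simp: inner_add_right mult_ac\<close>)
  moreover have "(\<lambda>y. f y *\<^sub>R G y + g y *\<^sub>R F y) differentiable (at y)" if "y \<in> S" for y
    using F G that by (intro differentiable_add differentiable_scaleR) (auto simp: differentiable_def)
  ultimately show ?thesis
    unfolding twice_differentiable_on_def
    by (intro exI[of _ "\<lambda>y. f y *\<^sub>R G y + g y *\<^sub>R F y"]) simp
qed

lemma twice_differentiable_on_compose:
  assumes "twice_differentiable_on \<phi> T" "twice_differentiable_on g S" "g ` S \<subseteq> T"
  shows "twice_differentiable_on (\<lambda>y. \<phi> (g y)) S"
proof -
  obtain F G where
    F: "\<forall>y\<in>T. (\<phi> has_derivative (\<lambda>d. d \<bullet> F y)) (at y) \<and> F differentiable (at y)" and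
    G: "\<forall>y\<in>S. (g has_derivative (\<lambda>d. d \<bullet> G y)) (at y) \<and> G differentiable (at y)"
    using assms unfolding twice_differentiable_on_def by blast
  have "((\<lambda>y. \<phi> (g y)) has_derivative (\<lambda>d. d \<bullet> (F (g y) *\<^sub>R G y))) (at y)" if "y \<in> S" for y
    by (rule has_derivative_eq_rhs[OF has_derivative_compose[where g = \<phi>]], use G that in blast,
        use F that assms(3) in blast) (simp add: mult_ac)
  moreover have "(\<lambda>y. F (g y) *\<^sub>R G y) differentiable (at y)" if "y \<in> S" for y
  proof (intro differentiable_scaleR)
    show "(\<lambda>y. F (g y)) differentiable (at y)"
      by (rule differentiable_compose) (use F G that assms(3) in \<open>auto simp: differentiable_def\<close>)
  qed (use G that in auto)
  ultimately show ?thesis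
    unfolding twice_differentiable_on_def
    by (intro exI[of _ "\<lambda>y. F (g y) *\<^sub>R G y"]) simp
qed

section \<open>Functions of one real variable\<close>

lemma twice_differentiable_on_realI:
  fixes \<phi> :: "real \<Rightarrow> real"
  assumes "\<And>x. x \<in> T \<Longrightarrow> (\<phi> has_real_derivative \<phi>' x) (at x)"
    and "\<And>x. x \<in> T \<Longrightarrow> \<phi>' differentiable (at x)"
  shows "twice_differentiable_on \<phi> T"
  unfolding twice_differentiable_on_def
  using assms by (intro exI[of _ \<phi>']) (auto simp: has_field_derivative_def mult_commute_abs)

lemma twice_differentiable_on_exp: "twice_differentiable_on exp (S :: real set)"
proof (rule twice_differentiable_on_realI)
  show exp: "(exp has_real_derivative exp x) (at x)" for x :: real
    by (rule DERIV_exp)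
  show "exp differentiable (at x)" for x :: real
    unfolding real_differentiable_def by (rule exI, rule exp)
qed

lemma twice_differentiable_on_sqrt: "twice_differentiable_on sqrt {0<..}"
proof (rule twice_differentiable_on_realI)
  fix x :: real assume x: "x \<in> {0<..}"
  show sqrt: "(sqrt has_real_derivative inverse (sqrt x) / 2) (at x)"
    using x by (intro DERIV_real_sqrt) auto
  show "(\<lambda>x. inverse (sqrt x) / 2) differentiable (at x)"
    using x sqrt by (intro differentiable_divide differentiable_inverse)
      (auto simp: real_differentiable_def)
qed

lemma twice_differentiable_on_inverse: "twice_differentiable_on inverse {0::real<..}"
proof (rule twice_differentiable_on_realI)
  fix x :: real assume x: "x \<in> {0<..}"
  show inv: "(inverse has_real_derivative - (inverse x * inverse x)) (at x)"
    using DERIV_inverse[of x] x by (simp add: power2_eq_square)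
  show "(\<lambda>x. - (inverse x * inverse x)) differentiable (at x)"
    using inv by (intro differentiable_minus differentiable_mult) (auto simp: real_differentiable_def)
qed

text \<open>The derivative of the inverse is \<open>inverse (r (g y))\<close>, a composition of
  functions that are differentiable at the points concerned, so it can be differentiated once
  more.\<close>

lemma twice_differentiable_on_inverse_function:
  fixes R :: "real \<Rightarrow> real"
  assumes "open S"
    and R: "\<And>x. x \<in> S \<Longrightarrow> (R has_real_derivative r x) (at x)"
    and r: "\<And>x. x \<in> S \<Longrightarrow> r differentiable (at x)"
    and "\<And>x. x \<in> S \<Longrightarrow> r x \<noteq> 0"
    and inv: "\<And>x. x \<in> S \<Longrightarrow> g (R x) = x"
  shows "twice_differentiable_on g (R ` S)"
proof -
  have cont: "continuous_on S R"
    by (rule DERIV_continuous_on, rule has_field_derivative_at_within, rule R)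
  have g: "(g has_real_derivative inverse (r x)) (at (R x))" if "x \<in> S" for x
    unfolding has_field_derivative_def
    by (rule has_derivative_inverse_strong[OF assms(1) that cont inv])
      (use that assms R[OF that] in \<open>auto simp: has_field_derivative_def\<close>)
  show ?thesis
  proof (rule twice_differentiable_on_realI)
    show "(g has_real_derivative inverse (r (g y))) (at y)" if "y \<in> R ` S" for y
      using that g inv by auto
    show "(\<lambda>y. inverse (r (g y))) differentiable (at y)" if "y \<in> R ` S" for y
    proof -
      from that obtain x where x: "x \<in> S" "y = R x" by auto
      have "(\<lambda>y. r (g y)) differentiable (at y)"
        by (rule differentiable_compose)
          (use g[OF x(1)] r[OF x(1)] inv[OF x(1)] x(2) in \<open>auto simp: real_differentiable_def\<close>)
      then show ?thesis
        using assms(4)[OF x(1)] inv[OF x(1)] x(2) by (intro differentiable_inverse) auto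
    qed
  qed
qed

text \<open>Links the coordinatewise \<open>hessian\<close>, an iterated \<open>deriv\<close>, to
  the derivative of the gradient: entry \<open>(i, j)\<close> is component \<open>j\<close> of
  \<open>G' (axis i 1)\<close>, and linearity of \<open>G'\<close> reassembles the quadratic
  form.\<close>

lemma hessian_quadratic_form:
  fixes g :: "real ^ 'n \<Rightarrow> real"
  assumes "open S" "y \<in> S"
    and g: "\<And>z. z \<in> S \<Longrightarrow> (g has_derivative (\<lambda>d. d \<bullet> G z)) (at z)"
    and G: "(G has_derivative G') (at y)"
  shows "d \<bullet> (hessian g y *v d) = d \<bullet> G' d"
proof -
  interpret G': linear G' using G by (rule has_derivative_linear)
  have line: "((\<lambda>s. z + s *\<^sub>R axis i 1) has_derivative (\<lambda>s. s *\<^sub>R axis i 1)) (at 0)"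
    for z :: "real ^ 'n" and i
    by (auto intro!: derivative_eq_intros)
  have partial: "partial_deriv j g z = G z $ j" if "z \<in> S" for j z
  proof -
    have "((\<lambda>s. g (z + s *\<^sub>R axis j 1)) has_derivative (\<lambda>s. (s *\<^sub>R axis j 1) \<bullet> G z)) (at 0)"
      by (rule has_derivative_compose[OF line]) (use g[OF that] in simp)
    then have "((\<lambda>s. g (z + s *\<^sub>R axis j 1)) has_real_derivative G z $ j) (at 0)"
      by (simp add: has_field_derivative_def inner_axis' mult_commute_abs)
    then show ?thesis
      unfolding partial_deriv_def by (rule DERIV_imp_deriv)
  qed
  have hess: "hessian g y $ i $ j = G' (axis i 1) $ j" for i j
  proof -
    have "((\<lambda>s. G (y + s *\<^sub>R axis i 1)) has_derivative (\<lambda>s. G' (s *\<^sub>R axis i 1))) (at 0)"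
      by (rule has_derivative_compose[OF line]) (use G in simp)
    then have "((\<lambda>s. G (y + s *\<^sub>R axis i 1) $ j) has_derivative (\<lambda>s. G' (s *\<^sub>R axis i 1) $ j)) (at 0)"
      by (rule bounded_linear.has_derivative[OF bounded_linear_vec_nth])
    then have "((\<lambda>s. G (y + s *\<^sub>R axis i 1) $ j) has_real_derivative G' (axis i 1) $ j) (at 0)"
      by (simp add: has_field_derivative_def G'.scaleR mult_commute_abs)
    \<comment> \<open>The first partial derivative is known to be \<open>G z $ j\<close> only for
      \<open>z\<close> in \<open>S\<close>. The outer derivative is local, so agreement on the open
      set of parameters that stay in \<open>S\<close> suffices.\<close>
    moreover have "open ((\<lambda>s. y + s *\<^sub>R axis i 1) -` S)"
      by (rule open_vimage[OF assms(1)]) (intro continuous_intros)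
    ultimately have "((\<lambda>s. partial_deriv j g (y + s *\<^sub>R axis i 1)) has_real_derivative G' (axis i 1) $ j) (at 0)"
      by (rule has_field_derivative_transform_within_open) (use assms(2) partial in auto)
    then show ?thesis
      unfolding hessian_def by (simp add: partial_deriv_def[of i] DERIV_imp_deriv)
  qed
  have "d \<bullet> (hessian g y *v d) = (\<Sum>i\<in>UNIV. d $ i * (d \<bullet> G' (axis i 1)))"
    by (simp add: inner_vec_def matrix_vector_mult_def hess mult.commute)
  also have "\<dots> = d \<bullet> G' (\<Sum>i\<in>UNIV. d $ i *\<^sub>R axis i 1)"
    by (simp add: G'.sum G'.scaleR inner_sum_right)
  also have "(\<Sum>i\<in>UNIV. d $ i *\<^sub>R axis i 1) = d"
    using basis_expansion[of d] by (simp add: scalar_mult_eq_scaleR)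
  finally show ?thesis .
qed

text \<open>
  The remainder is the integral of the derivative of \<open>\<theta> \<mapsto> (1 - \<theta>) h' \<theta> + h \<theta>\<close>, where \<open>h\<close> is the
  restriction of \<open>g\<close> to the segment; hence the second derivatives need not be continuous.
\<close>
lemma taylor_integral_remainder:
  fixes g :: "real ^ 'n \<Rightarrow> real"
  assumes "open S" "twice_differentiable_on g S"
    and seg: "\<And>\<theta>. \<theta> \<in> {0..1} \<Longrightarrow> \<theta> *\<^sub>R b + (1 - \<theta>) *\<^sub>R a \<in> S"
    and c: "((\<lambda>\<theta>. g (\<theta> *\<^sub>R b + (1 - \<theta>) *\<^sub>R a)) has_real_derivative c) (at 0)"
  shows "g b = g a + c + integral {0..1}
           (\<lambda>\<theta>. (1 - \<theta>) * ((b - a) \<bullet> (hessian g (\<theta> *\<^sub>R b + (1 - \<theta>) *\<^sub>R a) *v (b - a))))"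
proof -
  define y d where "y \<theta> = \<theta> *\<^sub>R b + (1 - \<theta>) *\<^sub>R a" and "d = b - a" for \<theta> :: real
  obtain G where
    g: "\<And>z. z \<in> S \<Longrightarrow> (g has_derivative (\<lambda>d. d \<bullet> G z)) (at z)" and
    G: "\<And>z. z \<in> S \<Longrightarrow> G differentiable (at z)"
    using assms(2) unfolding twice_differentiable_on_def by blast
  have y: "(y has_derivative (\<lambda>s. s *\<^sub>R d)) (at \<theta>)" for \<theta>
  proof -
    have "y = (\<lambda>\<theta>. a + \<theta> *\<^sub>R d)"
      by (simp add: fun_eq_iff y_def d_def algebra_simps)
    moreover have "((\<lambda>\<theta>. a + \<theta> *\<^sub>R d) has_derivative (\<lambda>s. s *\<^sub>R d)) (at \<theta>)"
      by (auto intro!: derivative_eq_intros)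
    ultimately show ?thesis by simp
  qed
  have yS: "y \<theta> \<in> S" if "\<theta> \<in> {0..1}" for \<theta>
    using seg[OF that] by (simp add: y_def)
  have h: "((\<lambda>\<theta>. g (y \<theta>)) has_real_derivative d \<bullet> G (y \<theta>)) (at \<theta>)" if "\<theta> \<in> {0..1}" for \<theta>
    unfolding has_field_derivative_def
    by (rule has_derivative_eq_rhs[OF has_derivative_compose[OF y g[OF yS[OF that]]]])
      (simp add: fun_eq_iff)
  have h': "((\<lambda>\<theta>. d \<bullet> G (y \<theta>)) has_real_derivative d \<bullet> (hessian g (y \<theta>) *v d)) (at \<theta>)"
    if "\<theta> \<in> {0..1}" for \<theta>
  proof -
    from G[OF yS[OF that]] obtain G' where G': "(G has_derivative G') (at (y \<theta>))"
      unfolding differentiable_def by blast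
    interpret G': linear G' using G' by (rule has_derivative_linear)
    have "((\<lambda>\<theta>. d \<bullet> G (y \<theta>)) has_derivative (\<lambda>s. d \<bullet> G' (s *\<^sub>R d))) (at \<theta>)"
      by (rule bounded_linear.has_derivative[OF bounded_linear_inner_right has_derivative_compose[OF y G']])
    then have "((\<lambda>\<theta>. d \<bullet> G (y \<theta>)) has_real_derivative d \<bullet> G' d) (at \<theta>)"
      by (simp add: has_field_derivative_def G'.scaleR mult_commute_abs)
    then show ?thesis
      using hessian_quadratic_form[OF assms(1) yS[OF that] g G'] by simp
  qed
  let ?k = "\<lambda>\<theta>. (1 - \<theta>) * (d \<bullet> G (y \<theta>)) + g (y \<theta>)"
  have "((\<lambda>\<theta>. (1 - \<theta>) * (d \<bullet> (hessian g (y \<theta>) *v d))) has_integral (?k 1 - ?k 0)) {0..1}"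
  proof (rule fundamental_theorem_of_calculus)
    fix \<theta> :: real assume \<theta>: "\<theta> \<in> {0..1}"
    have "((\<lambda>\<theta>. 1 - \<theta>) has_real_derivative - 1) (at \<theta>)"
      by (auto intro!: derivative_eq_intros)
    from DERIV_add[OF DERIV_mult[OF this h'[OF \<theta>]] h[OF \<theta>]]
    have "(?k has_real_derivative (1 - \<theta>) * (d \<bullet> (hessian g (y \<theta>) *v d))) (at \<theta>)"
      by (simp add: mult.commute)
    then show "(?k has_vector_derivative (1 - \<theta>) * (d \<bullet> (hessian g (y \<theta>) *v d))) (at \<theta> within {0..1})"
      unfolding has_real_derivative_iff_has_vector_derivative
      by (rule has_vector_derivative_at_within)
  qed simp
  then have "integral {0..1} (\<lambda>\<theta>. (1 - \<theta>) * (d \<bullet> (hessian g (y \<theta>) *v d))) = ?k 1 - ?k 0"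
    by (rule integral_unique)
  \<comment> \<open>The gradient is only known to exist; uniqueness of derivatives lets the
    explicitly computed directional derivative \<open>c\<close> stand for it.\<close>
  moreover have "d \<bullet> G (y 0) = c"
    by (rule DERIV_unique[OF h]) (use c in \<open>auto simp: y_def\<close>)
  moreover have "y 0 = a" "y 1 = b"
    by (auto simp: y_def)
  ultimately show ?thesis
    by (simp add: y_def d_def)
qed

subsection \<open>Integrability over momenta and internal energies\<close>

text \<open>This is the Gamma integrand after the substitution of \<open>c * t\<close> for
  \<open>t\<close>; the factor \<open>c powr (1 - a)\<close> compensates for the power of
  \<open>c\<close> that the substitution produces.\<close>

lemma integrable_powr_mult_exp:
  fixes a c :: real
  assumes "a > 0" "c > 0"
  shows "integrable lborel (\<lambda>t. indicator {0..} t * t powr (a - 1) * exp (- c * t))"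
proof -
  let ?f = "\<lambda>t. indicator {0..} t * t powr (a - 1) / exp t :: real"
  have "integrable lborel ?f"
  proof (rule integrableI_nonneg)
    show "(\<integral>\<^sup>+t. ennreal (?f t) \<partial>lborel) < \<infinity>"
      using Gamma_conv_nn_integral_real[OF assms(1)] by (metis ennreal_less_top infinity_ennreal_def)
  qed auto
  from lborel_integrable_real_affine[OF this, of c 0]
  have "integrable lborel (\<lambda>t. c powr (1 - a) * ?f (0 + c * t))"
    using assms by (intro integrable_mult_right) auto
  also have "(\<lambda>t. c powr (1 - a) * ?f (0 + c * t))
      = (\<lambda>t. indicator {0..} t * t powr (a - 1) * exp (- c * t))"
  proof
    fix t :: real
    have "c powr (1 - a) * c powr (a - 1) = 1"
      using assms by (simp flip: powr_add)
    then show "c powr (1 - a) * ?f (0 + c * t) = indicator {0..} t * t powr (a - 1) * exp (- c * t)"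
      using assms by (auto simp: indicator_def powr_mult zero_le_mult_iff exp_minus divide_inverse
          simp flip: mult.assoc)
  qed
  finally show ?thesis .
qed

lemma integrable_exp_abs:
  fixes c :: real
  assumes "c > 0"
  shows "integrable lborel (\<lambda>t::real. exp (- c * \<bar>t\<bar>))"
proof (rule Bochner_Integration.integrable_bound)
  let ?f = "\<lambda>t. indicator {0..} t * t powr (1 - 1) * exp (- c * t) :: real"
  have f: "integrable lborel ?f"
    by (rule integrable_powr_mult_exp) (use assms in auto)
  show "integrable lborel (\<lambda>t. ?f t + ?f (0 + (- 1) * t))"
    by (rule Bochner_Integration.integrable_add[OF f lborel_integrable_real_affine[OF f]]) simp
  show "AE t in lborel. norm (exp (- c * \<bar>t\<bar>)) \<le> norm (?f t + ?f (0 + (- 1) * t))"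
    \<comment> \<open>Since \<open>0 powr 0 = 0\<close>, the dominating function vanishes at the
      origin and the bound fails there, so this point is removed.\<close>
    using AE_lborel_singleton[of "0 :: real"]
    by eventually_elim (auto simp: indicator_def)
qed simp

text \<open>Each coordinate is at most the norm in absolute value, so with
  \<open>k = c / DIM('a)\<close> the exponential is dominated by a product of one-dimensional
  exponentials, whose integral factorises.\<close>

lemma integrable_exp_norm:
  assumes "c > 0"
  shows "integrable lborel (\<lambda>p::'a::euclidean_space. exp (- c * norm p))"
proof (rule Bochner_Integration.integrable_bound)
  define k where "k = c / DIM('a)"
  have k: "k > 0" using assms by (simp add: k_def)
  have fin: "(\<integral>\<^sup>+t. ennreal (exp (- k * \<bar>t\<bar>)) \<partial>lborel) < \<infinity>"
    using integrable_exp_abs[OF k] unfolding integrable_iff_bounded by simp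
  show "integrable lborel (\<lambda>p::'a. \<Prod>b\<in>Basis. exp (- k * \<bar>p \<bullet> b\<bar>))"
  proof (rule integrableI_nonneg)
    have "(\<integral>\<^sup>+p. ennreal (\<Prod>b\<in>Basis. exp (- k * \<bar>p \<bullet> b\<bar>)) \<partial>(lborel :: 'a measure))
        = (\<Prod>b\<in>(Basis :: 'a set). \<integral>\<^sup>+t. ennreal (exp (- k * \<bar>t\<bar>)) \<partial>lborel)"
      by (subst nn_integral_lborel_prod[symmetric]) (auto simp: prod_ennreal)
    also have "\<dots> < \<infinity>"
      using fin by (simp add: power_less_top_ennreal)
    finally show "(\<integral>\<^sup>+p. ennreal (\<Prod>b\<in>Basis. exp (- k * \<bar>p \<bullet> b\<bar>)) \<partial>(lborel :: 'a measure)) < \<infinity>" .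
  qed (auto simp: prod_nonneg)
  show "AE p::'a in lborel. norm (exp (- c * norm p)) \<le> norm (\<Prod>b\<in>Basis. exp (- k * \<bar>p \<bullet> b\<bar>))"
  proof (rule AE_I2)
    fix p :: 'a
    have "(\<Sum>b\<in>Basis. \<bar>p \<bullet> b\<bar>) \<le> (\<Sum>b\<in>(Basis :: 'a set). norm p)"
      by (intro sum_mono Basis_le_norm)
    then have "k * (\<Sum>b\<in>Basis. \<bar>p \<bullet> b\<bar>) \<le> k * (DIM('a) * norm p)"
      using k by (intro mult_left_mono) auto
    also have "\<dots> = c * norm p"
      by (simp add: k_def)
    finally have "exp (- c * norm p) \<le> exp (\<Sum>b\<in>Basis. - k * \<bar>p \<bullet> b\<bar>)"
      by (simp add: sum_distrib_left sum_negf)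
    then show "norm (exp (- c * norm p)) \<le> norm (\<Prod>b\<in>Basis. exp (- k * \<bar>p \<bullet> b\<bar>))"
      by (simp add: exp_sum prod_nonneg)
  qed
qed simp

lemma integrable_lborel_times:
  fixes a :: "'a::euclidean_space \<Rightarrow> real" and b :: "'b::euclidean_space \<Rightarrow> real"
  assumes a: "integrable lborel a" and b: "integrable lborel b"
  shows "integrable lborel (\<lambda>z. a (fst z) * b (snd z))"
proof -
  have [measurable]: "a \<in> borel_measurable lborel" "b \<in> borel_measurable lborel"
    using a b by auto
  have "integrable (lborel \<Otimes>\<^sub>M lborel) (\<lambda>z. a (fst z) * b (snd z))"
    by (rule lborel_pair.Fubini_integrable) (use a b in \<open>auto simp: abs_mult\<close>)
  then show ?thesis
    by (simp add: lborel_prod)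
qed

section \<open>Reflection of the momentum variable, and null open sets\<close>

lemma lborel_distr_uminus_euclidean:
  "distr lborel lborel uminus = (lborel :: 'a::euclidean_space measure)"
proof -
  have "distr lborel lborel uminus = (distr lborel borel (\<lambda>x. 0 + (- 1) *\<^sub>R x) :: 'a measure)"
    by (intro distr_cong) auto
  also have "\<dots> = lborel"
    using lborel_affine[of "- 1" "0 :: 'a"] by (simp add: density_1)
  finally show ?thesis .
qed

text \<open>The push-forward of a product measure under a product map is the product of the
  push-forwards, and Lebesgue measure is invariant under reflection. It serves to show that odd
  moments of the equilibrium vanish.\<close>

lemma integral_reflect_fst:
  fixes f :: "'a::euclidean_space \<times> 'b::euclidean_space \<Rightarrow> 'c::{banach, second_countable_topology}"
  assumes [measurable]: "f \<in> borel_measurable borel"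
  shows "(\<integral>z. f (- fst z, snd z) \<partial>lborel) = (\<integral>z. f z \<partial>lborel)"
proof -
  have "(lborel :: ('a \<times> 'b) measure) = distr lborel lborel uminus \<Otimes>\<^sub>M distr lborel lborel (\<lambda>x. x)"
    by (simp add: lborel_distr_uminus_euclidean distr_id2 lborel_prod)
  also have "\<dots> = distr (lborel \<Otimes>\<^sub>M lborel) (lborel \<Otimes>\<^sub>M lborel) (\<lambda>(x, y). (- x, y))"
    by (rule pair_measure_distr) (auto simp: distr_id2 intro: lborel.sigma_finite_measure_axioms)
  also have "\<dots> = distr lborel lborel (\<lambda>z. (- fst z, snd z))"
    by (simp add: lborel_prod case_prod_unfold)
  finally have eq: "distr lborel lborel (\<lambda>z. (- fst z, snd z)) = (lborel :: ('a \<times> 'b) measure)" by simp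
  have "(\<integral>z. f z \<partial>lborel) = (\<integral>z. f z \<partial>distr lborel lborel (\<lambda>z. (- fst z, snd z)))"
    by (simp add: eq)
  also have "\<dots> = (\<integral>z. f (- fst z, snd z) \<partial>lborel)"
    by (rule integral_distr) (auto intro!: borel_measurable_continuous_onI continuous_intros)
  finally show ?thesis by simp
qed

text \<open>A nonempty open set contains a ball of positive measure. This turns an almost-everywhere
  statement about continuous functions into a pointwise one.\<close>

lemma open_AE_notin_empty:
  fixes U :: "'a::euclidean_space set"
  assumes "open U" "AE z in lborel. z \<notin> U"
  shows "U = {}"
proof (rule ccontr)
  assume "U \<noteq> {}"
  then obtain c r where r: "r > 0" "ball c r \<subseteq> U"
    using assms(1) open_contains_ball by (metis all_not_in_conv)
  have "AE z in lborel. z \<notin> ball c r"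
    using assms(2) by eventually_elim (use r in auto)
  then have "emeasure lborel (ball c r) = 0"
    by (subst (asm) AE_iff_measurable[where N = "ball c r"]) auto
  then show False
    using r unit_ball_vol_pos[of "real DIM('a)"] by (simp add: emeasure_ball)
qed

subsection \<open>Moments as integrals against a weighted measure\<close>

definition phi_measure :: "real \<Rightarrow> ((real ^ 3) \<times> real) measure" where
  "phi_measure D = density lborel (\<lambda>z. ennreal (indicator (UNIV \<times> {0..}) z * phi D (snd z)))"

text \<open>
  The absolute value does not affect moments, which only see \<open>I \<ge> 0\<close>; it makes the bound
  \<open>energy z \<ge> 1\<close> hold everywhere.
\<close>
definition energy :: "(real ^ 3) \<times> real \<Rightarrow> real" where
  "energy z = (1 + \<bar>snd z\<bar>) * p0 (fst z)"

lemma p0_ge_1: "p0 p \<ge> 1"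
  by (simp add: p0_def)

lemma p0_pos: "p0 p > 0"
  using p0_ge_1[of p] by linarith

lemma norm_le_p0: "norm p \<le> p0 p"
  unfolding p0_def by (rule real_le_rsqrt) simp

lemma energy_measurable [measurable]: "energy \<in> borel_measurable borel"
proof -
  have "continuous_on UNIV energy"
    unfolding energy_def p0_def by (intro continuous_intros)
  then show ?thesis by (rule borel_measurable_continuous_onI)
qed

lemma weight_measurable [measurable]:
  "(\<lambda>z. indicator (UNIV \<times> {0..}) z * phi D (snd z)) \<in> borel_measurable (borel :: ((real ^ 3) \<times> real) measure)"
proof -
  have "(\<lambda>z. indicator {0..} (snd z) * (snd z) powr ((D - 2) / 2))
      \<in> borel_measurable (borel \<Otimes>\<^sub>M borel :: ((real ^ 3) \<times> real) measure)"
    by measurable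
  moreover have "(\<lambda>z. indicator (UNIV \<times> {0..}) z * phi D (snd z) :: real)
      = (\<lambda>z :: (real ^ 3) \<times> real. indicator {0..} (snd z) * (snd z) powr ((D - 2) / 2))"
    by (auto simp: fun_eq_iff phi_def indicator_def)
  ultimately show ?thesis
    by (simp add: borel_prod)
qed

lemma weight_nonneg: "0 \<le> indicator (UNIV \<times> {0..}) z * phi D (snd z)"
  by (simp add: phi_def)

lemma moment_eq_integral:
  assumes "h \<in> borel_measurable borel"
  shows "moment D (\<lambda>p I. h (p, I)) = integral\<^sup>L (phi_measure D) h"
  unfolding phi_measure_def moment_def set_lebesgue_integral_def
  using assms by (subst integral_density) (auto simp: weight_nonneg)

lemma moment_exists_iff_integrable:
  assumes "h \<in> borel_measurable borel"
  shows "moment_exists D (\<lambda>p I. h (p, I)) \<longleftrightarrow> integrable (phi_measure D) h"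
  unfolding phi_measure_def moment_exists_def set_integrable_def
  using assms by (subst integrable_density) (auto simp: weight_nonneg)

lemma moment_cong:
  assumes "\<And>p I. I \<ge> 0 \<Longrightarrow> h p I = h' p I"
  shows "moment D h = moment D h'"
  unfolding moment_def set_lebesgue_integral_def
  by (intro Bochner_Integration.integral_cong) (auto simp: indicator_def assms)

lemma moment_exists_cong:
  assumes "\<And>p I. I \<ge> 0 \<Longrightarrow> h p I = h' p I"
  shows "moment_exists D h \<longleftrightarrow> moment_exists D h'"
  unfolding moment_exists_def by (rule set_integrable_cong) (auto simp: assms)

lemma moment_add:
  assumes "moment_exists D h" "moment_exists D k"
  shows "moment D (\<lambda>p I. h p I + k p I) = moment D h + moment D k"
  using assms unfolding moment_exists_def moment_def by (simp_all add: scaleR_add_right)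

lemma
  assumes "moment_exists D h" "moment_exists D k"
  shows moment_exists_diff: "moment_exists D (\<lambda>p I. h p I - k p I)"
    and moment_diff: "moment D (\<lambda>p I. h p I - k p I) = moment D h - moment D k"
  using assms unfolding moment_exists_def moment_def by (simp_all add: scaleR_diff_right)

lemma moment_exists_scaleR:
  assumes "moment_exists D h"
  shows "moment_exists D (\<lambda>p I. c *\<^sub>R h p I)"
proof -
  have "integrable lborel (\<lambda>z. c *\<^sub>R (indicator (UNIV \<times> {0..}) z *\<^sub>R phi D (snd z) *\<^sub>R h (fst z) (snd z)))"
    using assms unfolding moment_exists_def set_integrable_def by (rule integrable_scaleR_right)
  then show ?thesis
    unfolding moment_exists_def set_integrable_def by (simp add: mult_ac)
qed

lemma moment_scaleR: "moment D (\<lambda>p I. c *\<^sub>R h p I) = c *\<^sub>R moment D h"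
proof -
  have "moment D (\<lambda>p I. c *\<^sub>R h p I)
      = (LINT z : UNIV \<times> {0..} | lborel. c *\<^sub>R (phi D (snd z) *\<^sub>R h (fst z) (snd z)))"
    unfolding moment_def by (simp add: mult.commute)
  then show ?thesis
    unfolding moment_def set_integral_scaleR_right .
qed

text \<open>Applied to the weights \<open>p / p0\<close> and \<open>1 / ((1 + I) p0)\<close>, this
  derives the convergence of all moments in use from that of the zeroth moment.\<close>

lemma moment_exists_bounded_mult:
  fixes k :: "(real ^ 3) \<times> real \<Rightarrow> 'b::{banach, second_countable_topology}"
  assumes g: "moment_exists D g" and [measurable]: "k \<in> borel_measurable borel"
    and k: "\<And>p I. I \<ge> 0 \<Longrightarrow> norm (k (p, I)) \<le> 1"
  shows "moment_exists D (\<lambda>p I. g p I *\<^sub>R k (p, I))"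
  unfolding moment_exists_def set_integrable_def
proof (rule Bochner_Integration.integrable_bound)
  let ?w = "\<lambda>z. indicator (UNIV \<times> {0..}) z *\<^sub>R phi D (snd z) *\<^sub>R g (fst z) (snd z)"
  show int: "integrable lborel ?w"
    using g unfolding moment_exists_def set_integrable_def .
  then have [measurable]: "?w \<in> borel_measurable lborel" by auto
  \<comment> \<open>Measurability is known for the weighted function \<open>?w\<close>, not for
    \<open>g\<close> itself, hence the regrouping.\<close>
  have eq: "(\<lambda>z. indicator (UNIV \<times> {0..}) z *\<^sub>R phi D (snd z) *\<^sub>R g (fst z) (snd z) *\<^sub>R k (fst z, snd z))
      = (\<lambda>z. ?w z *\<^sub>R k z)"
    by (simp add: fun_eq_iff mult_ac)
  show "(\<lambda>z. indicator (UNIV \<times> {0..}) z *\<^sub>R phi D (snd z) *\<^sub>R g (fst z) (snd z) *\<^sub>R k (fst z, snd z))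
      \<in> borel_measurable lborel"
    unfolding eq by measurable
  show "AE z in lborel. norm (indicator (UNIV \<times> {0..}) z *\<^sub>R phi D (snd z) *\<^sub>R g (fst z) (snd z)
      *\<^sub>R k (fst z, snd z)) \<le> norm (?w z)"
  proof (rule AE_I2)
    fix z :: "(real ^ 3) \<times> real"
    show "norm (indicator (UNIV \<times> {0..}) z *\<^sub>R phi D (snd z) *\<^sub>R g (fst z) (snd z)
        *\<^sub>R k (fst z, snd z)) \<le> norm (?w z)"
    proof (cases "snd z \<ge> 0")
      case True
      have "norm (?w z) * norm (k (fst z, snd z)) \<le> norm (?w z) * 1"
        by (intro mult_left_mono k True) simp
      then show ?thesis by (simp add: mult_ac abs_mult)
    qed (auto simp: indicator_def)
  qed
qed

text \<open>From \<open>norm p + I <= (1 + I) * p0 p\<close> the exponential is dominated by a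
  product of a function of \<open>p\<close> and a function of \<open>I\<close>.\<close>

lemma integrable_exp_energy:
  assumes "D > 0" "\<gamma> > 0"
  shows "integrable (phi_measure D) (\<lambda>z. exp (- \<gamma> * energy z))"
proof -
  let ?a = "\<lambda>p :: real ^ 3. exp (- \<gamma> * norm p)"
  let ?b = "\<lambda>I. indicator {0..} I * phi D I * exp (- \<gamma> * I) :: real"
  have "integrable lborel ?b"
    \<comment> \<open>The exponent \<open>(D - 2) / 2\<close> is \<open>D / 2 - 1\<close>, so
      positivity of \<open>D\<close> is exactly what the Gamma integral requires.\<close>
    using integrable_powr_mult_exp[of "D / 2" \<gamma>] assms by (simp add: phi_def diff_divide_distrib)
  have "integrable lborel (\<lambda>z. indicator (UNIV \<times> {0..}) z * phi D (snd z) * exp (- \<gamma> * energy z))"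
  proof (rule Bochner_Integration.integrable_bound)
    show "integrable lborel (\<lambda>z. ?a (fst z) * ?b (snd z))"
      using assms by (intro integrable_lborel_times integrable_exp_norm \<open>integrable lborel ?b\<close>) auto
    show "AE z :: (real ^ 3) \<times> real in lborel. norm (indicator (UNIV \<times> {0..}) z * phi D (snd z) * exp (- \<gamma> * energy z))
        \<le> norm (?a (fst z) * ?b (snd z))"
    proof (rule AE_I2)
      fix z :: "(real ^ 3) \<times> real"
      obtain p I where z: "z = (p, I)" by (cases z)
      show "norm (indicator (UNIV \<times> {0..}) z * phi D (snd z) * exp (- \<gamma> * energy z))
          \<le> norm (?a (fst z) * ?b (snd z))"
      proof (cases "I \<ge> 0")
        case True
        have "norm p \<le> p0 p" "I \<le> I * p0 p"
          using True norm_le_p0[of p] mult_left_mono[OF p0_ge_1[of p] True] by auto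
        then have "norm p + I \<le> energy z"
          using True by (simp add: energy_def z algebra_simps)
        then have "\<gamma> * (norm p + I) \<le> \<gamma> * energy z"
          using assms(2) by (intro mult_left_mono) auto
        then have "exp (- \<gamma> * energy z) \<le> exp (- \<gamma> * norm p) * exp (- \<gamma> * I)"
          by (simp add: algebra_simps flip: exp_add)
        then have "phi D I * exp (- \<gamma> * energy z) \<le> phi D I * (exp (- \<gamma> * norm p) * exp (- \<gamma> * I))"
          by (intro mult_left_mono) (auto simp: phi_def)
        then show ?thesis
          using True by (simp add: z phi_def abs_mult mult_ac)
      qed (simp add: z)
    qed
  qed measurable
  then show ?thesis
    unfolding phi_measure_def by (subst integrable_density) (auto simp: weight_nonneg)
qed

text \<open>The weight is positive for \<open>I > 0\<close>, so the open set where
  \<open>I > 0\<close> and the energy differs from \<open>c\<close> is null and therefore empty. But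
  the energy is \<open>2\<close> at \<open>(0, 1)\<close> and \<open>3\<close> at
  \<open>(0, 2)\<close>.\<close>

lemma energy_not_const: "\<not> (AE z in phi_measure D. energy z = c)"
proof
  assume "AE z in phi_measure D. energy z = c"
  then have "AE z in lborel. 0 < indicator (UNIV \<times> {0..}) z * phi D (snd z) \<longrightarrow> energy z = c"
    unfolding phi_measure_def by (subst (asm) AE_density) auto
  then have "AE z in lborel. z \<notin> {z. snd z > 0 \<and> energy z \<noteq> c}"
    by eventually_elim (auto simp: phi_def indicator_def)
  moreover have "open {z :: (real ^ 3) \<times> real. snd z > 0 \<and> energy z \<noteq> c}"
    unfolding energy_def p0_def
    by (intro open_Collect_conj open_Collect_less open_Collect_neq continuous_intros)
  ultimately have "{z :: (real ^ 3) \<times> real. snd z > 0 \<and> energy z \<noteq> c} = {}"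
    by (intro open_AE_notin_empty)
  then have "energy (0, 1) = c" "energy (0, 2) = c"
    by (auto simp: set_eq_iff)
  then show False
    by (simp add: energy_def p0_def)
qed

lemma exp_moments_phi:
  assumes "D > 0"
  shows "exp_moments (phi_measure D) energy"
proof
  show "energy \<in> borel_measurable (phi_measure D)"
    by (simp add: phi_measure_def)
  show "energy z \<ge> 1" for z
    using mult_mono[of 1 "1 + \<bar>snd z\<bar>" 1 "p0 (fst z)"] p0_ge_1[of "fst z"] by (simp add: energy_def)
qed (use assms integrable_exp_energy energy_not_const in auto)

subsection \<open>The parameter of the Juettner distribution\<close>

lemma exhaust_5:
  fixes i :: 5
  shows "i = 1 \<or> i = 2 \<or> i = 3 \<or> i = 4 \<or> i = 5"
proof (induct i)
  case (of_int z)
  \<comment> \<open>The representatives of the type \<open>5\<close> are \<open>0\<close> to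
    \<open>4\<close>, and \<open>0\<close> is the same element as \<open>5\<close>.\<close>
  then have "z = 0 \<or> z = 1 \<or> z = 2 \<or> z = 3 \<or> z = 4" by fastforce
  then show ?case by auto
qed

locale polyatomic =
  fixes D :: real
  assumes D_pos: "D > 0"

sublocale polyatomic \<subseteq> exp_moments "phi_measure D" energy
  by (rule exp_moments_phi) (rule D_pos)

context polyatomic
begin

lemma energy_eq: "I \<ge> 0 \<Longrightarrow> energy (p, I) = (1 + I) * p0 p"
  by (simp add: energy_def)

lemma E_borel: "E j \<gamma> \<in> borel_measurable borel"
  unfolding E_def by measurable

lemma moment_E: "moment D (\<lambda>p I. E j \<gamma> (p, I)) = W j \<gamma>"
  unfolding W_def by (rule moment_eq_integral[OF E_borel])

lemma moment_exists_E: "\<gamma> > 0 \<Longrightarrow> moment_exists D (\<lambda>p I. E j \<gamma> (p, I))"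
  by (simp add: moment_exists_iff_integrable[OF E_borel] integrable_E)

lemma E_eq:
  assumes "I \<ge> 0"
  shows "E 0 \<gamma> (p, I) = exp (- (1 + I) * \<gamma> * p0 p) / ((1 + I) * p0 p)"
    and "E 1 \<gamma> (p, I) = exp (- (1 + I) * \<gamma> * p0 p)"
proof -
  have "- (1 + I) * \<gamma> * p0 p = - \<gamma> * ((1 + I) * p0 p)"
    by (simp add: algebra_simps)
  then show "E 0 \<gamma> (p, I) = exp (- (1 + I) * \<gamma> * p0 p) / ((1 + I) * p0 p)"
    and "E 1 \<gamma> (p, I) = exp (- (1 + I) * \<gamma> * p0 p)"
    using assms p0_pos[of p] by (simp_all add: E_def energy_eq del: mult_minus_left)
qed

lemma M_fun_eq: "M_fun D = W 1" and Mt_fun_eq: "Mt_fun D = W 0"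
  unfolding fun_eq_iff M_fun_def Mt_fun_def moment_E[symmetric]
  by (auto intro!: moment_cong simp: E_eq simp del: One_nat_def)

lemma M_fun_pos: "\<gamma> > 0 \<Longrightarrow> M_fun D \<gamma> > 0"
  by (simp add: M_fun_eq W_pos del: One_nat_def)

lemma M_fun_has_derivative: "\<gamma> > 0 \<Longrightarrow> (M_fun D has_real_derivative - W 2 \<gamma>) (at \<gamma>)"
  using W_has_derivative[of \<gamma> 1] by (simp add: M_fun_eq numeral_2_eq_2)

lemma deriv_M_fun: "\<gamma> > 0 \<Longrightarrow> deriv (M_fun D) \<gamma> = - W 2 \<gamma>"
  by (rule DERIV_imp_deriv[OF M_fun_has_derivative])

lemma twice_differentiable_on_W: "twice_differentiable_on (W j) {0<..}"
proof (rule twice_differentiable_on_realI)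
  fix \<gamma> :: real assume "\<gamma> \<in> {0<..}"
  then have \<gamma>: "\<gamma> > 0" by simp
  show "(W j has_real_derivative - W (Suc j) \<gamma>) (at \<gamma>)"
    by (rule W_has_derivative[OF \<gamma>])
  show "(\<lambda>\<gamma>. - W (Suc j) \<gamma>) differentiable (at \<gamma>)"
    unfolding real_differentiable_def by (rule exI, rule DERIV_minus, rule W_has_derivative[OF \<gamma>])
qed

section \<open>The ratio \<open>Mt / M\<close> and its inverse function\<close>

definition M_ratio' :: "real \<Rightarrow> real" where
  "M_ratio' \<gamma> = W 0 \<gamma> * W 2 \<gamma> / (W 1 \<gamma>)\<^sup>2 - 1"

lemma M_ratio_has_derivative:
  assumes "\<gamma> > 0"
  shows "(M_ratio D has_real_derivative M_ratio' \<gamma>) (at \<gamma>)"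
proof -
  have W0: "(W 0 has_real_derivative - W 1 \<gamma>) (at \<gamma>)"
    and W1: "(W 1 has_real_derivative - W 2 \<gamma>) (at \<gamma>)"
    using W_has_derivative[OF assms, of 0] W_has_derivative[OF assms, of 1]
    by (simp_all add: numeral_2_eq_2)
  have pos: "W 1 \<gamma> \<noteq> 0" using W_pos[OF assms, of 1] by simp
  have eq: "M_ratio D = (\<lambda>\<gamma>. W 0 \<gamma> / W 1 \<gamma>)"
    by (simp add: fun_eq_iff M_ratio_def M_fun_eq Mt_fun_eq)
  have "((- W 1 \<gamma>) * W 1 \<gamma> - W 0 \<gamma> * (- W 2 \<gamma>)) / (W 1 \<gamma> * W 1 \<gamma>) = M_ratio' \<gamma>"
    using pos by (simp add: M_ratio'_def field_simps power2_eq_square)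
  then show ?thesis
    unfolding eq using DERIV_divide[OF W0 W1 pos] by simp
qed

lemma M_ratio'_pos:
  assumes "\<gamma> > 0"
  shows "M_ratio' \<gamma> > 0"
proof -
  have "(W 1 \<gamma>)\<^sup>2 > 0"
    using W_pos[OF assms, of 1] by simp
  with W_Cauchy_Schwarz_strict[OF assms] show ?thesis
    by (simp add: M_ratio'_def field_simps)
qed

lemma M_ratio'_differentiable:
  assumes "\<gamma> > 0"
  shows "M_ratio' differentiable (at \<gamma>)"
proof -
  have "W j differentiable (at \<gamma>)" for j
    unfolding real_differentiable_def by (rule exI, rule W_has_derivative[OF assms])
  moreover have "W 1 \<gamma> \<noteq> 0"
    using W_pos[OF assms, of 1] by simp
  ultimately show ?thesis
    unfolding M_ratio'_def
    by (intro differentiable_diff differentiable_divide differentiable_mult differentiable_power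
        differentiable_const) auto
qed

lemma M_ratio_strict_mono:
  assumes "0 < a" "a < b"
  shows "M_ratio D a < M_ratio D b"
proof (rule DERIV_pos_imp_increasing[OF assms(2)])
  fix x assume "a \<le> x" "x \<le> b"
  then have "x > 0" using assms by simp
  then show "\<exists>y. DERIV (M_ratio D) x :> y \<and> y > 0"
    using M_ratio_has_derivative M_ratio'_pos by blast
qed

lemma inj_on_M_ratio: "inj_on (M_ratio D) {0<..}"
  by (rule linorder_inj_onI) (use M_ratio_strict_mono in \<open>fastforce+\<close>)

lemma chi_inv_M_ratio: "\<gamma> > 0 \<Longrightarrow> chi_inv D (M_ratio D \<gamma>) = \<gamma>"
  unfolding chi_inv_def by (rule the_inv_into_f_f[OF inj_on_M_ratio]) simp

definition eta_range :: "real set" where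
  "eta_range = M_ratio D ` {0<..}"

lemma continuous_on_M_ratio: "continuous_on {0<..} (M_ratio D)"
  by (rule DERIV_continuous_on, rule has_field_derivative_at_within, rule M_ratio_has_derivative) simp

text \<open>A continuous injective function on an open subset of the line is an open map. Openness
  of the parameter domain is required by the Taylor formula.\<close>

lemma open_eta_range: "open eta_range"
  unfolding eta_range_def
  by (rule injective_into_1d_imp_open_map_UNIV[OF _ continuous_on_M_ratio inj_on_M_ratio]) auto

text \<open>A connected subset of the line is an interval. Consequently the whole segment from
  \<open>eta0 D \<gamma>0\<close> to an admissible \<open>\<eta>\<close> stays in the domain of
  \<open>chi_inv\<close>.\<close>

lemma convex_eta_range: "convex eta_range"
proof -
  have "connected eta_range"
    unfolding eta_range_def
    by (rule connected_continuous_image[OF continuous_on_M_ratio]) (simp add: convex_connected)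
  then show ?thesis
    by (simp add: is_interval_connected_1[symmetric] is_interval_convex_1)
qed

lemma chi_inv_pos: "\<eta> \<in> eta_range \<Longrightarrow> chi_inv D \<eta> > 0"
  using chi_inv_M_ratio by (auto simp: eta_range_def)

lemma twice_differentiable_on_chi_inv: "twice_differentiable_on (chi_inv D) eta_range"
  unfolding eta_range_def
proof (rule twice_differentiable_on_inverse_function)
  fix x :: real assume "x \<in> {0<..}"
  then have x: "x > 0" by simp
  show "(M_ratio D has_real_derivative M_ratio' x) (at x)" by (rule M_ratio_has_derivative[OF x])
  show "M_ratio' differentiable (at x)" by (rule M_ratio'_differentiable[OF x])
  show "M_ratio' x \<noteq> 0" using M_ratio'_pos[OF x] by simp
  show "chi_inv D (M_ratio D x) = x" by (rule chi_inv_M_ratio[OF x])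
qed simp

text \<open>Twice differentiability only asserts that a derivative exists; the linear part of the
  expansion needs its value.\<close>

lemma chi_inv_has_derivative:
  assumes "\<gamma> > 0"
  shows "(chi_inv D has_real_derivative inverse (M_ratio' \<gamma>)) (at (M_ratio D \<gamma>))"
proof -
  have "open {0::real<..}" "\<gamma> \<in> {0<..}" using assms by auto
  then show ?thesis
    unfolding has_field_derivative_def
    by (rule has_derivative_inverse_strong[OF _ _ continuous_on_M_ratio])
      (use assms chi_inv_M_ratio M_ratio'_pos[OF assms] M_ratio_has_derivative[OF assms] in
        \<open>auto simp: has_field_derivative_def\<close>)
qed

text \<open>As \<open>M' = - W 2\<close>, the denominator \<open>M\<^sup>2 + M' * Mt\<close> equals
  \<open>(W 1)\<^sup>2 - W 0 * W 2\<close>, which is nonzero by strict Cauchy-Schwarz. The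
  coefficient is thus minus the derivative of \<open>chi_inv\<close> at the equilibrium
  value.\<close>

lemma eta_coeff_eq:
  assumes "\<gamma> > 0"
  shows "eta_coeff D \<gamma> = - inverse (M_ratio' \<gamma>)"
proof -
  have alg: "a\<^sup>2 / (a\<^sup>2 + - c * b) = - inverse (b * c / a\<^sup>2 - 1)"
    if "a \<noteq> 0" "b * c - a\<^sup>2 \<noteq> 0" for a b c :: real
    using that by (simp add: divide_simps) (simp add: algebra_simps)
  have "W 1 \<gamma> \<noteq> 0" "W 0 \<gamma> * W 2 \<gamma> - (W 1 \<gamma>)\<^sup>2 \<noteq> 0"
    using W_pos[OF assms, of 1] W_Cauchy_Schwarz_strict[OF assms] by auto
  from alg[OF this] show ?thesis
    unfolding eta_coeff_def M_fun_eq Mt_fun_eq deriv_M_fun[OF assms, unfolded M_fun_eq] M_ratio'_def .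
qed

section \<open>Regularity and expansion of the Juettner distribution\<close>

lemma twice_differentiable_on_juettner_params:
  "twice_differentiable_on (juettner_params D p I) {y. y $ 5 \<in> eta_range}"
proof -
  let ?S = "{y :: real ^ 5. y $ 5 \<in> eta_range}"
  have chi: "twice_differentiable_on (\<lambda>y. chi_inv D (y $ 5)) ?S"
    by (rule twice_differentiable_on_compose[OF twice_differentiable_on_chi_inv twice_differentiable_on_nth])
      auto
  have M: "twice_differentiable_on (\<lambda>y. M_fun D (chi_inv D (y $ 5))) ?S"
    unfolding M_fun_eq
    by (rule twice_differentiable_on_compose[OF twice_differentiable_on_W chi]) (use chi_inv_pos in auto)
  have inv: "twice_differentiable_on (\<lambda>y. inverse (M_fun D (chi_inv D (y $ 5)))) ?S"
    by (rule twice_differentiable_on_compose[OF twice_differentiable_on_inverse M])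
      (use chi_inv_pos M_fun_pos in auto)
  have sqrt: "twice_differentiable_on (\<lambda>y. sqrt (1 + (y $ 2 * y $ 2 + y $ 3 * y $ 3 + y $ 4 * y $ 4))) ?S"
    by (rule twice_differentiable_on_compose[OF twice_differentiable_on_sqrt])
      (auto intro!: twice_differentiable_on_add twice_differentiable_on_mult twice_differentiable_on_nth
        twice_differentiable_on_const add_pos_nonneg)
  \<comment> \<open>This is \<open>u0 * p0 - u \<bullet> p\<close> in coordinates, written with sums
    and products only so that the closure rules apply.\<close>
  let ?K = "\<lambda>y :: real ^ 5. sqrt (1 + (y $ 2 * y $ 2 + y $ 3 * y $ 3 + y $ 4 * y $ 4)) * p0 p
      + (y $ 2 * - p $ 1 + y $ 3 * - p $ 2 + y $ 4 * - p $ 3)"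
  have K: "twice_differentiable_on ?K ?S"
    by (intro twice_differentiable_on_add twice_differentiable_on_mult twice_differentiable_on_nth
        twice_differentiable_on_const sqrt)
  have "twice_differentiable_on (\<lambda>y. exp (- (1 + I) * (chi_inv D (y $ 5) * ?K y))) ?S"
    by (rule twice_differentiable_on_compose[OF twice_differentiable_on_exp[of UNIV]])
      (intro twice_differentiable_on_mult twice_differentiable_on_const chi K subset_UNIV)+
  then have "twice_differentiable_on (\<lambda>y. y $ 1 * inverse (M_fun D (chi_inv D (y $ 5)))
      * exp (- (1 + I) * (chi_inv D (y $ 5) * ?K y))) ?S"
    by (intro twice_differentiable_on_mult twice_differentiable_on_nth inv)
  also have "(\<lambda>y. y $ 1 * inverse (M_fun D (chi_inv D (y $ 5)))
      * exp (- (1 + I) * (chi_inv D (y $ 5) * ?K y))) = juettner_params D p I"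
  proof
    fix y :: "real ^ 5"
    have "(norm (vector [y $ 2, y $ 3, y $ 4] :: real ^ 3))\<^sup>2 = y $ 2 * y $ 2 + y $ 3 * y $ 3 + y $ 4 * y $ 4"
      and "(vector [y $ 2, y $ 3, y $ 4] :: real ^ 3) \<bullet> p = y $ 2 * p $ 1 + y $ 3 * p $ 2 + y $ 4 * p $ 3"
      by (simp_all add: power2_norm_eq_inner inner_vec_def sum_3)
    then show "y $ 1 * inverse (M_fun D (chi_inv D (y $ 5)))
      * exp (- (1 + I) * (chi_inv D (y $ 5) * ?K y)) = juettner_params D p I y"
      by (simp add: juettner_params_def juettner_def Let_def divide_inverse mult.assoc)
  qed
  finally show ?thesis .
qed

lemma juettner_equilibrium:
  assumes "\<gamma>0 > 0"
  shows "juettner D 1 0 (eta0 D \<gamma>0) p I = F0 D \<gamma>0 p I"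
  by (simp add: juettner_def Let_def eta0_def chi_inv_M_ratio[OF assms] F0_def algebra_simps)

text \<open>Logarithmic differentiation at the equilibrium: the density contributes
  \<open>\<nu>\<close>, the normalisation \<open>1 / M\<close> contributes
  \<open>- (M' / M) * q'\<close>, and the exponent contributes
  \<open>- (1 + I) * (q' * p0 p - \<gamma>0 * (u \<bullet> p))\<close>. The rate \<open>q'\<close>
  of the parameter is \<open>- eta_coeff D \<gamma>0 * \<delta>\<close>.\<close>

lemma juettner_line_has_derivative:
  assumes "\<gamma>0 > 0"
  shows "((\<lambda>\<theta>. juettner D (1 + \<theta> * \<nu>) (\<theta> *\<^sub>R u) (eta0 D \<gamma>0 + \<theta> * \<delta>) p I) has_real_derivative
      F0 D \<gamma>0 p I * (\<nu> + \<gamma>0 * (1 + I) * (u \<bullet> p)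
        + eta_coeff D \<gamma>0 * (deriv (M_fun D) \<gamma>0 / M_fun D \<gamma>0 + (1 + I) * p0 p) * \<delta>)) (at 0)"
proof -
  define q where "q \<theta> = chi_inv D (eta0 D \<gamma>0 + \<theta> * \<delta>)" for \<theta>
  define q' where "q' = inverse (M_ratio' \<gamma>0) * \<delta>"
  define K where "K \<theta> = sqrt (1 + (\<theta> * norm u)\<^sup>2) * p0 p - \<theta> * (u \<bullet> p)" for \<theta>
  define e where "e \<theta> = exp (- (1 + I) * (q \<theta> * K \<theta>))" for \<theta>
  let ?M = "M_fun D \<gamma>0"
  have q0: "q 0 = \<gamma>0"
    by (simp add: q_def eta0_def chi_inv_M_ratio[OF assms])
  have K0: "K 0 = p0 p" by (simp add: K_def)
  have M: "?M \<noteq> 0" using M_fun_pos[OF assms] by simp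
  have q: "(q has_real_derivative q') (at 0)"
    unfolding q_def q'_def
    by (rule DERIV_chain'[of "\<lambda>\<theta>. eta0 D \<gamma>0 + \<theta> * \<delta>" \<delta>, THEN DERIV_cong])
      (use chi_inv_has_derivative[OF assms] in \<open>auto simp: eta0_def intro!: derivative_eq_intros\<close>)
  have Mq: "((\<lambda>\<theta>. M_fun D (q \<theta>)) has_real_derivative - W 2 \<gamma>0 * q') (at 0)"
    by (rule DERIV_chain'[OF q]) (simp add: q0 M_fun_has_derivative[OF assms])
  have inv: "((\<lambda>\<theta>. inverse (M_fun D (q \<theta>))) has_real_derivative inverse ?M * (W 2 \<gamma>0 * q') * inverse ?M) (at 0)"
    using DERIV_inverse'[OF Mq] M by (simp add: q0)
  \<comment> \<open>The root \<open>sqrt (1 + (\<theta> * norm u)\<^sup>2)\<close> is even in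
    \<open>\<theta>\<close>, so to first order only the term with \<open>u \<bullet> p\<close>
    remains.\<close>
  have K: "(K has_real_derivative - (u \<bullet> p)) (at 0)"
    unfolding K_def by (auto intro!: derivative_eq_intros)
  have qK: "((\<lambda>\<theta>. q \<theta> * K \<theta>) has_real_derivative q' * p0 p - (u \<bullet> p) * \<gamma>0) (at 0)"
    using DERIV_mult[OF q K] by (simp add: q0 K0)
  have e: "(e has_real_derivative e 0 * (- (1 + I) * (q' * p0 p - (u \<bullet> p) * \<gamma>0))) (at 0)"
    unfolding e_def by (rule DERIV_fun_exp[OF DERIV_cmult[OF qK]])
  have lin: "((\<lambda>\<theta>. 1 + \<theta> * \<nu>) has_real_derivative \<nu>) (at 0)"
    by (auto intro!: derivative_eq_intros)
  have F0: "F0 D \<gamma>0 p I = inverse ?M * e 0"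
    by (simp add: F0_def e_def q0 K0 divide_inverse algebra_simps)
  have "juettner D (1 + \<theta> * \<nu>) (\<theta> *\<^sub>R u) (eta0 D \<gamma>0 + \<theta> * \<delta>) p I
      = (1 + \<theta> * \<nu>) * inverse (M_fun D (q \<theta>)) * e \<theta>" for \<theta>
    by (simp add: juettner_def Let_def e_def K_def q_def divide_inverse power_mult_distrib mult.assoc)
  then show ?thesis
    using DERIV_mult[OF DERIV_mult[OF lin inv] e]
    by (elim ssubst[OF ext] DERIV_cong)
      (use M M_ratio'_pos[OF assms] in \<open>simp add: F0 q0 deriv_M_fun[OF assms] eta_coeff_eq[OF assms]
        q'_def field_simps\<close>)
qed

text \<open>Taylor's formula on the segment of transitional parameters. In coordinates this segment
  is the line of \<open>juettner_line_has_derivative\<close> with increments \<open>n - 1\<close>,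
  \<open>u\<close> and \<open>\<eta> - eta0 D \<gamma>0\<close>, which supplies the first-order
  term.\<close>

lemma juettner_taylor:
  assumes "\<gamma>0 > 0" "\<eta> \<in> eta_range"
  shows "juettner D n u \<eta> p I = F0 D \<gamma>0 p I
    + F0 D \<gamma>0 p I * ((n - 1) + \<gamma>0 * (1 + I) * (u \<bullet> p)
        + eta_coeff D \<gamma>0 * (deriv (M_fun D) \<gamma>0 / M_fun D \<gamma>0 + (1 + I) * p0 p) * (\<eta> - eta0 D \<gamma>0))
    + integral {0..1} (\<lambda>\<theta>. (1 - \<theta>) * (params (n - 1) u (\<eta> - eta0 D \<gamma>0) \<bullet>
        (hessian (juettner_params D p I) (\<theta> *\<^sub>R params n u \<eta> + (1 - \<theta>) *\<^sub>R params 1 0 (eta0 D \<gamma>0))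
          *v params (n - 1) u (\<eta> - eta0 D \<gamma>0))))"
proof -
  let ?\<eta>0 = "eta0 D \<gamma>0"
  let ?S = "{y :: real ^ 5. y $ 5 \<in> eta_range}"
  have nth: "params a v b $ 1 = a" "params a v b $ 2 = v $ 1" "params a v b $ 3 = v $ 2"
      "params a v b $ 4 = v $ 3" "params a v b $ 5 = b" for a v b
    by (simp_all add: params_def vector_def)
  have line: "\<theta> *\<^sub>R params n u \<eta> + (1 - \<theta>) *\<^sub>R params 1 0 ?\<eta>0
      = params (1 + \<theta> * (n - 1)) (\<theta> *\<^sub>R u) (?\<eta>0 + \<theta> * (\<eta> - ?\<eta>0))" for \<theta>
    unfolding vec_eq_iff
  proof
    fix i :: 5
    show "(\<theta> *\<^sub>R params n u \<eta> + (1 - \<theta>) *\<^sub>R params 1 0 ?\<eta>0) $ i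
        = params (1 + \<theta> * (n - 1)) (\<theta> *\<^sub>R u) (?\<eta>0 + \<theta> * (\<eta> - ?\<eta>0)) $ i"
      using exhaust_5[of i] by (elim disjE) (simp_all add: nth algebra_simps)
  qed
  have diff: "params n u \<eta> - params 1 0 ?\<eta>0 = params (n - 1) u (\<eta> - ?\<eta>0)"
    unfolding vec_eq_iff
  proof
    fix i :: 5
    show "(params n u \<eta> - params 1 0 ?\<eta>0) $ i = params (n - 1) u (\<eta> - ?\<eta>0) $ i"
      using exhaust_5[of i] by (elim disjE) (simp_all add: nth)
  qed
  have "open ((\<lambda>y :: real ^ 5. y $ 5) -` eta_range)"
    by (rule open_vimage[OF open_eta_range]) (intro continuous_intros)
  then have op: "open ?S" by (simp add: vimage_def)
  have seg: "\<theta> *\<^sub>R params n u \<eta> + (1 - \<theta>) *\<^sub>R params 1 0 ?\<eta>0 \<in> ?S" if "\<theta> \<in> {0..1}" for \<theta>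
  proof -
    have "?\<eta>0 \<in> eta_range" using assms(1) by (simp add: eta0_def eta_range_def)
    then have "\<theta> *\<^sub>R \<eta> + (1 - \<theta>) *\<^sub>R ?\<eta>0 \<in> eta_range"
      using that assms(2) convex_eta_range by (intro convexD) auto
    then show ?thesis by (simp add: nth)
  qed
  note deriv = juettner_line_has_derivative[OF assms(1), of "n - 1" u "\<eta> - ?\<eta>0" p I,
      folded juettner_params_params, folded line]
  show ?thesis
    using taylor_integral_remainder[OF op twice_differentiable_on_juettner_params seg deriv]
    unfolding diff juettner_params_params juettner_equilibrium[OF assms(1)] .
qed

subsection \<open>Macroscopic fields and the source term\<close>

lemma F0_pos: "\<gamma>0 > 0 \<Longrightarrow> F0 D \<gamma>0 p I > 0"
  by (simp add: F0_def M_fun_pos)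

lemma F0_eq_E:
  assumes "I \<ge> 0"
  shows "F0 D \<gamma>0 p I = (1 / M_fun D \<gamma>0) *\<^sub>R E 1 \<gamma>0 (p, I)"
proof -
  have "- \<gamma>0 * (1 + I) * p0 p = - (1 + I) * \<gamma>0 * p0 p"
    by (simp add: algebra_simps)
  then show ?thesis
    unfolding F0_def E_eq(2)[OF assms] by simp
qed

lemma moment_exists_F0:
  assumes "\<gamma>0 > 0"
  shows "moment_exists D (F0 D \<gamma>0)"
  using moment_exists_scaleR[OF moment_exists_E[OF assms, of 1], of "1 / M_fun D \<gamma>0"]
  by (subst moment_exists_cong[OF F0_eq_E])

lemma moment_F0:
  assumes "\<gamma>0 > 0"
  shows "moment D (F0 D \<gamma>0) = 1"
proof -
  have "moment D (F0 D \<gamma>0) = moment D (\<lambda>p I. (1 / M_fun D \<gamma>0) *\<^sub>R E 1 \<gamma>0 (p, I))"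
    by (rule moment_cong[OF F0_eq_E])
  also have "\<dots> = 1"
    unfolding moment_scaleR moment_E using W_pos[OF assms, of 1] by (simp add: M_fun_eq)
  finally show ?thesis .
qed

lemma moment_F0_energy:
  assumes "\<gamma>0 > 0"
  shows "moment D (\<lambda>p I. F0 D \<gamma>0 p I / ((1 + I) * p0 p)) = eta0 D \<gamma>0"
proof -
  have "F0 D \<gamma>0 p I / ((1 + I) * p0 p) = (1 / M_fun D \<gamma>0) *\<^sub>R E 0 \<gamma>0 (p, I)" if "I \<ge> 0" for p I
    using F0_eq_E[OF that, of \<gamma>0 p] unfolding E_eq[OF that] by simp
  then have "moment D (\<lambda>p I. F0 D \<gamma>0 p I / ((1 + I) * p0 p))
      = moment D (\<lambda>p I. (1 / M_fun D \<gamma>0) *\<^sub>R E 0 \<gamma>0 (p, I))"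
    by (rule moment_cong)
  also have "\<dots> = eta0 D \<gamma>0"
    unfolding moment_scaleR moment_E by (simp add: eta0_def M_ratio_def Mt_fun_eq)
  finally show ?thesis .
qed

text \<open>The equilibrium depends on \<open>p\<close> only through \<open>p0 p\<close>, so the
  integrand is odd in \<open>p\<close> and the flux equals its own negative.\<close>

lemma flux_F0: "flux D (F0 D \<gamma>0) = 0"
proof -
  \<comment> \<open>Rewriting through \<open>energy\<close> changes nothing where the weight is
    nonzero and exhibits the integrand as a measurable function on the whole space.\<close>
  let ?f = "\<lambda>z. (indicator (UNIV \<times> {0..}) z * phi D (snd z)) *\<^sub>R
      ((1 / M_fun D \<gamma>0) * exp (- \<gamma>0 * energy z) / p0 (fst z)) *\<^sub>R fst z"
  have eq: "flux D (F0 D \<gamma>0) = integral\<^sup>L lborel ?f"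
    unfolding flux_def moment_def set_lebesgue_integral_def
  proof (rule Bochner_Integration.integral_cong)
    fix z :: "(real ^ 3) \<times> real"
    show "indicator (UNIV \<times> {0..}) z *\<^sub>R phi D (snd z) *\<^sub>R (F0 D \<gamma>0 (fst z) (snd z) / p0 (fst z)) *\<^sub>R fst z
        = ?f z"
      by (cases "snd z \<ge> 0") (auto simp: indicator_def F0_def energy_def mult_ac)
  qed simp
  have fst_meas: "(\<lambda>z. p0 (fst z)) \<in> borel_measurable (borel :: ((real ^ 3) \<times> real) measure)"
    unfolding p0_def by (intro borel_measurable_continuous_onI continuous_intros)
  have fst_meas': "fst \<in> borel_measurable (borel :: ((real ^ 3) \<times> real) measure)"
    by (intro borel_measurable_continuous_onI continuous_intros)
  have "?f \<in> borel_measurable borel"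
    using fst_meas fst_meas' by measurable
  then have "integral\<^sup>L lborel ?f = (\<integral>z. ?f (- fst z, snd z) \<partial>lborel)"
    by (rule integral_reflect_fst[symmetric])
  also have "\<dots> = (\<integral>z. - ?f z \<partial>lborel)"
    by (rule Bochner_Integration.integral_cong) (auto simp: indicator_def energy_def p0_def)
  also have "\<dots> = - integral\<^sup>L lborel ?f" by simp
  finally have "flux D (F0 D \<gamma>0) = - flux D (F0 D \<gamma>0)"
    unfolding eq .
  then show ?thesis
    by (simp add: vec_eq_iff)
qed

text \<open>All fields are moments and therefore see only \<open>I >= 0\<close>, which is the range
  in which the decomposition of \<open>F\<close> is prescribed.\<close>

lemma F_E_cong:
  assumes "\<And>p I. I \<ge> 0 \<Longrightarrow> G p I = H p I"
  shows "F_E D G = F_E D H" and "has_juettner_parameters D G \<longleftrightarrow> has_juettner_parameters D H"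
proof -
  have "moment D G = moment D H" "flux D G = flux D H"
      "moment D (\<lambda>p I. G p I / ((1 + I) * p0 p)) = moment D (\<lambda>p I. H p I / ((1 + I) * p0 p))"
    unfolding flux_def by (auto intro!: moment_cong simp: assms)
  then have "number_sq D G = number_sq D H" "n_of D G = n_of D H" "u_of D G = u_of D H"
      "eta_of D G = eta_of D H"
    by (simp_all add: number_sq_def n_of_def u_of_def eta_of_def)
  moreover have "moment_exists D G \<longleftrightarrow> moment_exists D H"
    by (rule moment_exists_cong) (rule assms)
  ultimately show "F_E D G = F_E D H" and "has_juettner_parameters D G \<longleftrightarrow> has_juettner_parameters D H"
    by (simp_all add: F_E_def has_juettner_parameters_def)
qed

lemma moment_exists_flux:
  assumes "moment_exists D g"
  shows "moment_exists D (\<lambda>p I. (g p I / p0 p) *\<^sub>R p)"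
proof -
  let ?k = "\<lambda>z :: (real ^ 3) \<times> real. (1 / p0 (fst z)) *\<^sub>R fst z"
  have "?k \<in> borel_measurable borel"
    unfolding p0_def
    by (intro borel_measurable_continuous_onI continuous_intros) (auto simp: add_nonneg_eq_0_iff)
  moreover have "norm (?k (p, I)) \<le> 1" for p I
    using norm_le_p0[of p] p0_pos[of p] by simp
  ultimately show ?thesis
    using moment_exists_bounded_mult[OF assms, of ?k] by simp
qed

lemma moment_exists_energy:
  assumes "moment_exists D g"
  shows "moment_exists D (\<lambda>p I. g p I / ((1 + I) * p0 p))"
proof -
  let ?k = "\<lambda>z. 1 / energy z"
  have "norm (?k z) \<le> 1" for z
    using X_ge_1[of z] X_pos[of z] by simp
  then have "moment_exists D (\<lambda>p I. g p I *\<^sub>R ?k (p, I))"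
    by (intro moment_exists_bounded_mult[OF assms]) auto
  then show ?thesis
    by (subst moment_exists_cong[where h' = "\<lambda>p I. g p I *\<^sub>R ?k (p, I)"]) (auto simp: energy_eq)
qed

section \<open>Fields of the perturbed distribution\<close>

context
  fixes \<gamma>0 :: real and g :: "real ^ 3 \<Rightarrow> real \<Rightarrow> real"
  assumes \<gamma>0: "\<gamma>0 > 0" and juettner: "has_juettner_parameters D (perturbed D \<gamma>0 g)"
begin

lemma perturbed_eq: "perturbed D \<gamma>0 g = (\<lambda>p I. F0 D \<gamma>0 p I + g p I * sqrt (F0 D \<gamma>0 p I))"
  by (simp add: fun_eq_iff perturbed_def mult.commute)

text \<open>The fluctuation is the difference of the perturbed distribution and the equilibrium,
  which both have a convergent zeroth moment.\<close>

lemma moment_exists_fluctuation: "moment_exists D (\<lambda>p I. g p I * sqrt (F0 D \<gamma>0 p I))"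
proof -
  have "moment_exists D (\<lambda>p I. perturbed D \<gamma>0 g p I - F0 D \<gamma>0 p I)"
    using juettner by (intro moment_exists_diff moment_exists_F0[OF \<gamma>0]) (simp add: has_juettner_parameters_def)
  then show ?thesis by (simp add: perturbed_eq)
qed

lemma moment_perturbed: "moment D (perturbed D \<gamma>0 g) = 1 + A_of D \<gamma>0 g"
  unfolding perturbed_eq moment_add[OF moment_exists_F0[OF \<gamma>0] moment_exists_fluctuation]
  by (simp add: moment_F0[OF \<gamma>0] A_of_def)

lemma flux_perturbed: "flux D (perturbed D \<gamma>0 g) = B_of D \<gamma>0 g"
  using moment_add[OF moment_exists_flux[OF moment_exists_F0[OF \<gamma>0]]
      moment_exists_flux[OF moment_exists_fluctuation]] flux_F0[of \<gamma>0]
  by (simp add: perturbed_eq flux_def B_of_def add_divide_distrib scaleR_add_left)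

lemma moment_perturbed_energy: "moment D (\<lambda>p I. perturbed D \<gamma>0 g p I / ((1 + I) * p0 p))
    = eta0 D \<gamma>0 + J_of D \<gamma>0 g"
  using moment_add[OF moment_exists_energy[OF moment_exists_F0[OF \<gamma>0]]
      moment_exists_energy[OF moment_exists_fluctuation]] moment_F0_energy[OF \<gamma>0]
  by (simp add: perturbed_eq J_of_def add_divide_distrib)

lemma moment_fluctuation_energy:
  "moment D (\<lambda>p I. (1 / ((1 + I) * p0 p) - eta0 D \<gamma>0) * g p I * sqrt (F0 D \<gamma>0 p I))
    = J_of D \<gamma>0 g - eta0 D \<gamma>0 * A_of D \<gamma>0 g"
proof -
  have "(\<lambda>p I. (1 / ((1 + I) * p0 p) - eta0 D \<gamma>0) * g p I * sqrt (F0 D \<gamma>0 p I))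
      = (\<lambda>p I. g p I * sqrt (F0 D \<gamma>0 p I) / ((1 + I) * p0 p)
          - eta0 D \<gamma>0 *\<^sub>R (g p I * sqrt (F0 D \<gamma>0 p I)))"
    by (simp add: fun_eq_iff left_diff_distrib)
  then show ?thesis
    using moment_diff[OF moment_exists_energy[OF moment_exists_fluctuation]
        moment_exists_scaleR[OF moment_exists_fluctuation, of "eta0 D \<gamma>0"]]
      moment_scaleR[of D "eta0 D \<gamma>0" "\<lambda>p I. g p I * sqrt (F0 D \<gamma>0 p I)"]
    by (simp add: J_of_def A_of_def)
qed

lemma number_sq_perturbed: "number_sq D (perturbed D \<gamma>0 g) = 1 + Phi_of D \<gamma>0 g"
proof -
  have "(\<Sum>i\<in>UNIV. (B_of D \<gamma>0 g $ i)\<^sup>2) = (norm (B_of D \<gamma>0 g))\<^sup>2"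
    by (simp add: power2_norm_eq_inner inner_vec_def) (simp add: power2_eq_square)
  then show ?thesis
    by (simp add: number_sq_def moment_perturbed flux_perturbed Phi_of_def power2_eq_square algebra_simps)
qed

text \<open>With \<open>s = sqrt (1 + \<Phi>)\<close> one has
  \<open>2 + \<Phi> + 2 * s = (s + 1)\<^sup>2\<close> and \<open>\<Phi> = (s - 1) * (s + 1)\<close>.
  The fraction in \<open>N_n\<close> is therefore \<open>(s - 1)\<^sup>2 / 2\<close>, and
  \<open>A + N_n\<close> collapses to \<open>s - 1\<close>.\<close>

lemma n_perturbed: "n_of D (perturbed D \<gamma>0 g) = 1 + A_of D \<gamma>0 g + N_n D \<gamma>0 g"
  and n_perturbed_pos: "n_of D (perturbed D \<gamma>0 g) > 0"
proof -
  define s where "s = n_of D (perturbed D \<gamma>0 g)"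
  let ?\<Phi> = "Phi_of D \<gamma>0 g"
  have pos: "1 + ?\<Phi> > 0"
    using juettner by (simp add: has_juettner_parameters_def number_sq_perturbed)
  have s: "s = sqrt (1 + ?\<Phi>)"
    by (simp add: s_def n_of_def number_sq_perturbed)
  show s_pos: "n_of D (perturbed D \<gamma>0 g) > 0"
    using pos s by (simp add: s_def)
  have \<Phi>: "?\<Phi> = s\<^sup>2 - 1"
    using pos by (simp add: s)
  have T: "?\<Phi>\<^sup>2 / (2 * (2 + ?\<Phi> + 2 * s)) = (s - 1)\<^sup>2 / 2"
  proof -
    have "2 + ?\<Phi> + 2 * s = (s + 1)\<^sup>2" "?\<Phi>\<^sup>2 = (s - 1)\<^sup>2 * (s + 1)\<^sup>2"
      unfolding \<Phi> by (simp_all add: power2_eq_square algebra_simps)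
    moreover have "(s + 1)\<^sup>2 \<noteq> 0" using s_pos s_def by simp
    ultimately show ?thesis by simp
  qed
  have half: "?\<Phi> / 2 = A_of D \<gamma>0 g + (A_of D \<gamma>0 g)\<^sup>2 / 2 - (norm (B_of D \<gamma>0 g))\<^sup>2 / 2"
    by (simp add: Phi_of_def field_simps)
  have "A_of D \<gamma>0 g + N_n D \<gamma>0 g = ?\<Phi> / 2 - (s - 1)\<^sup>2 / 2"
    unfolding N_n_def Let_def s[symmetric] T unfolding half by simp
  also have "\<dots> = s - 1"
    unfolding \<Phi> by (simp add: power2_eq_square field_simps)
  finally show "n_of D (perturbed D \<gamma>0 g) = 1 + A_of D \<gamma>0 g + N_n D \<gamma>0 g"
    by (simp add: s_def)
qed

text \<open>Write \<open>1 / n = 1 - (n - 1) / n\<close> with \<open>n - 1 = A + N_n\<close>; the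
  first summand gives \<open>B\<close>, the second \<open>N_u\<close>.\<close>

lemma u_perturbed: "u_of D (perturbed D \<gamma>0 g) = B_of D \<gamma>0 g + N_u D \<gamma>0 g"
proof -
  have "1 / n_of D (perturbed D \<gamma>0 g) = 1 - (A_of D \<gamma>0 g + N_n D \<gamma>0 g) / (1 + A_of D \<gamma>0 g + N_n D \<gamma>0 g)"
    using n_perturbed_pos unfolding n_perturbed by (simp add: field_simps)
  then show ?thesis
    by (simp add: u_of_def flux_perturbed N_u_def scaleR_left_diff_distrib)
qed

lemma eta_perturbed:
  "eta_of D (perturbed D \<gamma>0 g) - eta0 D \<gamma>0 = J_of D \<gamma>0 g - eta0 D \<gamma>0 * A_of D \<gamma>0 g + N_eta D \<gamma>0 g"
proof -
  define \<Psi> where "\<Psi> = A_of D \<gamma>0 g + N_n D \<gamma>0 g"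
  have n: "n_of D (perturbed D \<gamma>0 g) = 1 + \<Psi>" by (simp add: n_perturbed \<Psi>_def)
  have pos: "1 + \<Psi> \<noteq> 0" using n_perturbed_pos n by simp
  have A: "A_of D \<gamma>0 g = \<Psi> - N_n D \<gamma>0 g" by (simp add: \<Psi>_def)
  \<comment> \<open>In terms of \<open>r\<close> all quotients in \<open>N_eta\<close> become
    affine, and the identity reduces to the expansion of \<open>r * (eta0 + J)\<close>.\<close>
  define r where "r = 1 / (1 + \<Psi>)"
  have r: "\<Psi> / (1 + \<Psi>) = 1 - r" "\<Psi>\<^sup>2 / (1 + \<Psi>) = \<Psi> - 1 + r"
    using pos by (simp_all add: r_def field_simps power2_eq_square)
  have "eta_of D (perturbed D \<gamma>0 g) = r * (eta0 D \<gamma>0 + J_of D \<gamma>0 g)"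
    by (simp add: eta_of_def n moment_perturbed_energy r_def)
  then show ?thesis
    unfolding N_eta_def Psi_of_def Let_def \<Psi>_def[symmetric] r unfolding A
    by (simp add: algebra_simps)
qed

text \<open>In the Taylor expansion each increment is a linear functional of \<open>g\<close> plus a
  correction. The linear functionals assemble to \<open>P0_op\<close>, the corrections
  \<open>N_n\<close>, \<open>N_u\<close>, \<open>N_eta\<close> to the first three terms of
  \<open>Gamma_op\<close>, and the Hessian remainder is its last term.\<close>

lemma source_identity:
  assumes "I \<ge> 0"
  shows "1 / ((1 + I) * p0 p) * (F_E D (perturbed D \<gamma>0 g) p I - perturbed D \<gamma>0 g p I)
    = sqrt (F0 D \<gamma>0 p I)
      * (1 / ((1 + I) * p0 p) * (P0_op D \<gamma>0 g p I - g p I) + Gamma_op D \<gamma>0 g p I)"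
proof -
  let ?G = "perturbed D \<gamma>0 g"
  define w where "w = sqrt (F0 D \<gamma>0 p I)"
  define X where "X = (1 + I) * p0 p"
  define c where "c = eta_coeff D \<gamma>0"
  define m where "m = deriv (M_fun D) \<gamma>0 / M_fun D \<gamma>0"
  let ?d = "params (n_of D ?G - 1) (u_of D ?G) (eta_of D ?G - eta0 D \<gamma>0)"
  define H where "H = integral {0..1} (\<lambda>\<theta>. (1 - \<theta>) * (?d \<bullet>
        (hessian (juettner_params D p I) (\<theta> *\<^sub>R params (n_of D ?G) (u_of D ?G) (eta_of D ?G)
            + (1 - \<theta>) *\<^sub>R params 1 0 (eta0 D \<gamma>0)) *v ?d)))"
  have w: "w > 0" and w2: "F0 D \<gamma>0 p I = w * w"
    using F0_pos[OF \<gamma>0, of p I] by (simp_all add: w_def)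
  have X: "X > 0"
    using assms p0_pos[of p] by (simp add: X_def)
  have "eta_of D ?G \<in> eta_range"
    using juettner by (simp add: has_juettner_parameters_def eta_range_def)
  from juettner_taylor[OF \<gamma>0 this, of "n_of D ?G" "u_of D ?G" p I]
  have FE: "F_E D ?G p I = w * w + w * w * ((A_of D \<gamma>0 g + N_n D \<gamma>0 g)
      + \<gamma>0 * (1 + I) * ((B_of D \<gamma>0 g + N_u D \<gamma>0 g) \<bullet> p)
      + c * (m + X) * (J_of D \<gamma>0 g - eta0 D \<gamma>0 * A_of D \<gamma>0 g + N_eta D \<gamma>0 g)) + H"
    unfolding F_E_def H_def[symmetric] unfolding eta_perturbed u_perturbed w2 X_def c_def m_def
    by (simp add: n_perturbed)
  have GG: "?G p I = w * w + w * g p I"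
    unfolding perturbed_def w_def[symmetric] unfolding w2 by simp
  have P0: "P0_op D \<gamma>0 g p I = A_of D \<gamma>0 g * w + \<gamma>0 * (B_of D \<gamma>0 g \<bullet> p) * (1 + I) * w
      + c * (J_of D \<gamma>0 g - eta0 D \<gamma>0 * A_of D \<gamma>0 g) * (m + X) * w"
    unfolding P0_op_def Let_def moment_fluctuation_energy c_def m_def w_def X_def
    by (simp add: A_of_def B_of_def)
  have \<Gamma>: "Gamma_op D \<gamma>0 g p I = N_n D \<gamma>0 g * w / X + \<gamma>0 * ((N_u D \<gamma>0 g \<bullet> p) / p0 p) * w
      + c * (1 / X * m + 1) * N_eta D \<gamma>0 g * w + 1 / (X * w) * H"
    unfolding Gamma_op_def Let_def H_def[symmetric] w_def[symmetric] X_def[symmetric]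
      c_def[symmetric] m_def[symmetric] by simp
  have "1 + I \<noteq> 0" using assms by simp
  \<comment> \<open>The \<open>N_u\<close> term of \<open>Gamma_op\<close> carries
    \<open>1 / p0\<close>, whereas the expansion carries \<open>(1 + I) / X\<close>; this brings
    both to the denominator \<open>X\<close>.\<close>
  then have div: "a / p0 p = a * (1 + I) / X" for a
    by (simp add: X_def)
  have "F_E D ?G p I - ?G p I
      = w * (1 / X * (P0_op D \<gamma>0 g p I - g p I) + Gamma_op D \<gamma>0 g p I) * X"
    unfolding P0 \<Gamma> FE GG div
    using w X by (simp add: field_simps inner_add_left)
  then show ?thesis
    unfolding w_def[symmetric] X_def[symmetric] using X by simp
qed

end

end

section \<open>Passage between the two transport equations\<close>

lemma transport_eq_affine:
  assumes "transport_eq f t x p I S" "t \<ge> 0"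
    and F: "\<And>s y. s \<ge> 0 \<Longrightarrow> F s y p I = a + c * f s y p I"
  shows "transport_eq F t x p I (c * S)"
proof -
  obtain ht hx where ht: "((\<lambda>s. f s x p I) has_real_derivative ht) (at t within {0..})"
    and hx: "GDERIV (\<lambda>y. f t y p I) x :> hx" and S: "ht + ((1 / p0 p) *\<^sub>R p) \<bullet> hx = S"
    using assms(1) unfolding transport_eq_def by blast
  have "((\<lambda>s. a + c * f s x p I) has_real_derivative c * ht) (at t within {0..})"
    using DERIV_add[OF DERIV_const DERIV_cmult[OF ht], of a c] by simp
  \<comment> \<open>The affine relation is assumed for \<open>s >= 0\<close> only, which is the set
    within which the time derivative is taken.\<close>
  then have "((\<lambda>s. F s x p I) has_real_derivative c * ht) (at t within {0..})"
    unfolding has_field_derivative_def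
    by (rule has_derivative_transform[rotated 2]) (use assms(2) F in auto)
  moreover have "((\<lambda>y. f t y p I) has_derivative (\<lambda>h. h \<bullet> hx)) (at x)"
    using hx by (simp add: gderiv_def)
  then have "((\<lambda>y. a + c * f t y p I) has_derivative (\<lambda>h. h \<bullet> (c *\<^sub>R hx))) (at x)"
    using has_derivative_add[OF has_derivative_const has_derivative_mult_right] by fastforce
  then have "GDERIV (\<lambda>y. F t y p I) x :> c *\<^sub>R hx"
    by (simp add: gderiv_def F[OF assms(2)])
  moreover have "c * ht + ((1 / p0 p) *\<^sub>R p) \<bullet> (c *\<^sub>R hx) = c * S"
    by (simp add: S[symmetric] algebra_simps)
  ultimately show ?thesis
    unfolding transport_eq_def by blast
qed

theorem proposition2p1:
  fixes D \<gamma>0 L :: real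
    and f F :: "real \<Rightarrow> real ^ 3 \<Rightarrow> real ^ 3 \<Rightarrow> real \<Rightarrow> real"
  assumes "D > 0" and "\<gamma>0 > 0" and "L > 0"
    and "torus_periodic L f"
    and "\<And>t x p I. t \<ge> 0 \<Longrightarrow> I \<ge> 0 \<Longrightarrow>
           F t x p I = F0 D \<gamma>0 p I + sqrt (F0 D \<gamma>0 p I) * f t x p I"
    and "\<And>t x. t \<ge> 0 \<Longrightarrow> has_juettner_parameters D (F t x)"
  shows "\<forall>t\<ge>0. \<forall>x p. \<forall>I\<ge>0. marle_eq D F t x p I \<longleftrightarrow> perturbation_eq D \<gamma>0 f t x p I"
proof (intro allI impI)
  fix t I :: real and y q :: "real ^ 3"
  assume t: "t \<ge> 0" and I: "I \<ge> 0"
  interpret polyatomic D by unfold_locales (rule assms(1))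
  define w where "w = sqrt (F0 D \<gamma>0 q I)"
  have w: "w \<noteq> 0" using F0_pos[OF assms(2), of q I] by (simp add: w_def)
  let ?R = "1 / ((1 + I) * p0 q) * (P0_op D \<gamma>0 (f t y) q I - f t y q I) + Gamma_op D \<gamma>0 (f t y) q I"
  have F: "F s z q I = F0 D \<gamma>0 q I + w * f s z q I" if "s \<ge> 0" for s z
    using assms(5)[OF that I] by (simp add: w_def)
  \<comment> \<open>Since \<open>w\<close> is nonzero the relation can be inverted and is affine
    again, with coefficients constant in time and space; the same lemma thus serves both
    directions.\<close>
  then have f: "f s z q I = - F0 D \<gamma>0 q I / w + (1 / w) * F s z q I" if "s \<ge> 0" for s z
    using w that by (simp add: field_simps)
  have Ft: "F t y p' I' = perturbed D \<gamma>0 (f t y) p' I'" if "I' \<ge> 0" for p' I'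
    using assms(5)[OF t that] by (simp add: perturbed_def)
  have "has_juettner_parameters D (perturbed D \<gamma>0 (f t y))"
    using assms(6)[OF t, of y] F_E_cong(2)[OF Ft] by simp
  note identity = source_identity[OF assms(2) this I, of q]
  have FE: "F_E D (F t y) = F_E D (perturbed D \<gamma>0 (f t y))"
    by (rule F_E_cong(1)) (rule Ft)
  \<comment> \<open>The factor \<open>w\<close> pulled out here is the one that multiplies
    \<open>f\<close> in \<open>F\<close>, so the two equations have proportional right-hand
    sides.\<close>
  have source: "1 / ((1 + I) * p0 q) * (F_E D (F t y) q I - F t y q I) = w * ?R"
    unfolding FE Ft[OF I] w_def by (rule identity)
  have "transport_eq F t y q I (w * ?R) \<longleftrightarrow> transport_eq f t y q I ?R"
  proof
    assume "transport_eq F t y q I (w * ?R)"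
    then have "transport_eq f t y q I (1 / w * (w * ?R))"
      using t by (rule transport_eq_affine) (rule f)
    then show "transport_eq f t y q I ?R"
      using w by simp
  next
    assume "transport_eq f t y q I ?R"
    then show "transport_eq F t y q I (w * ?R)"
      using t by (rule transport_eq_affine) (rule F)
  qed
  then show "marle_eq D F t y q I \<longleftrightarrow> perturbation_eq D \<gamma>0 f t y q I"
    unfolding marle_eq_def perturbation_eq_def source .
qed

end
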